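(* Let $k$ be a field of characteristic $\ne 2$ equipped with a non-empty set $V$ of non-trivial discrete valuations. If there are integers $r, s \geq 1$ such that all quadratic forms over $k$ satisfy $\mathrm{LGP}(r,s)$ with respect to $V$, then for every integer $j$ (not necessarily positive) with $r+j \geq 1$ and $s+j \geq 1$, all quadratic forms over $k$ satisfy $\mathrm{LGP}(r+j, s+j)$ with respect to $V$.
   Context: All quadratic forms are regular. $i_W(q)$ denotes the Witt index of $q$. For $v \in V$, $k_v$ is the $v$-adic completion and $q_v = q_{k_v}$. For integers $a,b \ge 1$, a form $q$ over $k$ satisfies $\mathrm{LGP}(a,b)$ with respect to $V$ if ($i_W(q_v) \geq a$ for all $v \in V$) implies $i_W(q) \geq b$. *)

theory Defs
  imports "HOL-Algebra.QuotRing"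
begin

section \<open>Discrete valuations and completions\<close>

text \<open>
  A discrete valuation is given by its integer values on the nonzero elements of the field; it is
  not required to be normalized. The value at zero is morally infinite: \<open>v \<zero>\<close> is never
  inspected, and \<open>val_ge\<close> takes care of this case.
\<close>

definition discrete_valuation :: "('a, 'b) ring_scheme \<Rightarrow> ('a \<Rightarrow> int) \<Rightarrow> bool" where
  "discrete_valuation K v \<longleftrightarrow>
     (\<forall>x \<in> carrier K - {\<zero>\<^bsub>K\<^esub>}. \<forall>y \<in> carrier K - {\<zero>\<^bsub>K\<^esub>}.
        v (x \<otimes>\<^bsub>K\<^esub> y) = v x + v y \<and>
        (x \<oplus>\<^bsub>K\<^esub> y \<noteq> \<zero>\<^bsub>K\<^esub> \<longrightarrow> min (v x) (v y) \<le> v (x \<oplus>\<^bsub>K\<^esub> y)))"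

definition nontrivial_valuation :: "('a, 'b) ring_scheme \<Rightarrow> ('a \<Rightarrow> int) \<Rightarrow> bool" where
  "nontrivial_valuation K v \<longleftrightarrow> (\<exists>x \<in> carrier K - {\<zero>\<^bsub>K\<^esub>}. v x \<noteq> 0)"

definition val_ge :: "('a, 'b) ring_scheme \<Rightarrow> ('a \<Rightarrow> int) \<Rightarrow> 'a \<Rightarrow> int \<Rightarrow> bool" where
  "val_ge K v x N \<longleftrightarrow> x = \<zero>\<^bsub>K\<^esub> \<or> N \<le> v x"

definition cauchy_seqs :: "('a, 'b) ring_scheme \<Rightarrow> ('a \<Rightarrow> int) \<Rightarrow> (nat \<Rightarrow> 'a) set" where
  "cauchy_seqs K v =
     {s. range s \<subseteq> carrier K \<and>
         (\<forall>N. \<exists>M. \<forall>m\<ge>M. \<forall>n\<ge>M. val_ge K v (s m \<ominus>\<^bsub>K\<^esub> s n) N)}"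

definition null_seqs :: "('a, 'b) ring_scheme \<Rightarrow> ('a \<Rightarrow> int) \<Rightarrow> (nat \<Rightarrow> 'a) set" where
  "null_seqs K v =
     {s \<in> cauchy_seqs K v. \<forall>N. \<exists>M. \<forall>n\<ge>M. val_ge K v (s n) N}"

definition cauchy_ring :: "('a, 'b) ring_scheme \<Rightarrow> ('a \<Rightarrow> int) \<Rightarrow> (nat \<Rightarrow> 'a) ring" where
  "cauchy_ring K v =
     \<lparr>carrier = cauchy_seqs K v,
      mult = (\<lambda>s t n. s n \<otimes>\<^bsub>K\<^esub> t n),
      one = (\<lambda>n. \<one>\<^bsub>K\<^esub>),
      zero = (\<lambda>n. \<zero>\<^bsub>K\<^esub>),
      add = (\<lambda>s t n. s n \<oplus>\<^bsub>K\<^esub> t n)\<rparr>"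

definition completion :: "('a, 'b) ring_scheme \<Rightarrow> ('a \<Rightarrow> int) \<Rightarrow> ((nat \<Rightarrow> 'a) set) ring" where
  "completion K v = cauchy_ring K v Quot null_seqs K v"

definition completion_embed ::
    "('a, 'b) ring_scheme \<Rightarrow> ('a \<Rightarrow> int) \<Rightarrow> 'a \<Rightarrow> (nat \<Rightarrow> 'a) set" where
  "completion_embed K v c = null_seqs K v +>\<^bsub>cauchy_ring K v\<^esub> (\<lambda>n. c)"


section \<open>Quadratic forms\<close>

text \<open>
  \<open>QForm n c\<close> stands for the homogeneous quadratic polynomial
  \<open>\<Sum>i\<le>j<n. c i j * x\<^sub>i * x\<^sub>j\<close>; coefficients at other positions are irrelevant.
  The zero-dimensional form is allowed, as it occurs as an anisotropic part.
\<close>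

datatype 'a qform = QForm (qdim: nat) (qcoeff: "nat \<Rightarrow> nat \<Rightarrow> 'a")

text \<open>The space \<open>K\<^sup>n\<close>, with vectors padded by zeros so that addition is pointwise.\<close>

definition vecs :: "('a, 'b) ring_scheme \<Rightarrow> nat \<Rightarrow> (nat \<Rightarrow> 'a) set" where
  "vecs K n = {x. (\<forall>i<n. x i \<in> carrier K) \<and> (\<forall>i\<ge>n. x i = \<zero>\<^bsub>K\<^esub>)}"

definition vec_add :: "('a, 'b) ring_scheme \<Rightarrow> (nat \<Rightarrow> 'a) \<Rightarrow> (nat \<Rightarrow> 'a) \<Rightarrow> nat \<Rightarrow> 'a" where
  "vec_add K x y = (\<lambda>i. x i \<oplus>\<^bsub>K\<^esub> y i)"

definition vec_smult :: "('a, 'b) ring_scheme \<Rightarrow> 'a \<Rightarrow> (nat \<Rightarrow> 'a) \<Rightarrow> nat \<Rightarrow> 'a" where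
  "vec_smult K c x = (\<lambda>i. c \<otimes>\<^bsub>K\<^esub> x i)"

definition vec_zero :: "('a, 'b) ring_scheme \<Rightarrow> nat \<Rightarrow> 'a" where
  "vec_zero K = (\<lambda>i. \<zero>\<^bsub>K\<^esub>)"

definition qeval :: "('a, 'b) ring_scheme \<Rightarrow> 'a qform \<Rightarrow> (nat \<Rightarrow> 'a) \<Rightarrow> 'a" where
  "qeval K q x =
     (\<Oplus>\<^bsub>K\<^esub>j \<in> {..<qdim q}. \<Oplus>\<^bsub>K\<^esub>i \<in> {..j}. qcoeff q i j \<otimes>\<^bsub>K\<^esub> x i \<otimes>\<^bsub>K\<^esub> x j)"

definition qpolar :: "('a, 'b) ring_scheme \<Rightarrow> 'a qform \<Rightarrow> (nat \<Rightarrow> 'a) \<Rightarrow> (nat \<Rightarrow> 'a) \<Rightarrow> 'a" where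
  "qpolar K q x y = qeval K q (vec_add K x y) \<ominus>\<^bsub>K\<^esub> qeval K q x \<ominus>\<^bsub>K\<^esub> qeval K q y"

definition quadratic_form :: "('a, 'b) ring_scheme \<Rightarrow> 'a qform \<Rightarrow> bool" where
  "quadratic_form K q \<longleftrightarrow> (\<forall>i j. i \<le> j \<and> j < qdim q \<longrightarrow> qcoeff q i j \<in> carrier K)"

definition regular_form :: "('a, 'b) ring_scheme \<Rightarrow> 'a qform \<Rightarrow> bool" where
  "regular_form K q \<longleftrightarrow> quadratic_form K q \<and>
     (\<forall>x \<in> vecs K (qdim q). (\<forall>y \<in> vecs K (qdim q). qpolar K q x y = \<zero>\<^bsub>K\<^esub>) \<longrightarrow> x = vec_zero K)"

definition anisotropic :: "('a, 'b) ring_scheme \<Rightarrow> 'a qform \<Rightarrow> bool" where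
  "anisotropic K q \<longleftrightarrow> (\<forall>x \<in> vecs K (qdim q). qeval K q x = \<zero>\<^bsub>K\<^esub> \<longrightarrow> x = vec_zero K)"

definition linear_iso ::
    "('a, 'b) ring_scheme \<Rightarrow> nat \<Rightarrow> nat \<Rightarrow> ((nat \<Rightarrow> 'a) \<Rightarrow> (nat \<Rightarrow> 'a)) \<Rightarrow> bool" where
  "linear_iso K m n f \<longleftrightarrow> bij_betw f (vecs K m) (vecs K n) \<and>
     (\<forall>x \<in> vecs K m. \<forall>y \<in> vecs K m. f (vec_add K x y) = vec_add K (f x) (f y)) \<and>
     (\<forall>c \<in> carrier K. \<forall>x \<in> vecs K m. f (vec_smult K c x) = vec_smult K c (f x))"

definition isometric :: "('a, 'b) ring_scheme \<Rightarrow> 'a qform \<Rightarrow> 'a qform \<Rightarrow> bool" where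
  "isometric K q q' \<longleftrightarrow> (\<exists>f. linear_iso K (qdim q) (qdim q') f \<and>
     (\<forall>x \<in> vecs K (qdim q). qeval K q' (f x) = qeval K q x))"

definition orth_sum :: "('a, 'b) ring_scheme \<Rightarrow> 'a qform \<Rightarrow> 'a qform \<Rightarrow> 'a qform" where
  "orth_sum K q q' = QForm (qdim q + qdim q')
     (\<lambda>i j. if i < qdim q \<and> j < qdim q then qcoeff q i j
            else if qdim q \<le> i \<and> qdim q \<le> j then qcoeff q' (i - qdim q) (j - qdim q)
            else \<zero>\<^bsub>K\<^esub>)"

text \<open>The hyperbolic plane is the form \<open>x\<^sub>0 * x\<^sub>1\<close>.\<close>

definition hyperbolic_plane :: "('a, 'b) ring_scheme \<Rightarrow> 'a qform" where
  "hyperbolic_plane K = QForm 2 (\<lambda>i j. if i = 0 \<and> j = 1 then \<one>\<^bsub>K\<^esub> else \<zero>\<^bsub>K\<^esub>)"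

primrec hyperbolic_form :: "('a, 'b) ring_scheme \<Rightarrow> nat \<Rightarrow> 'a qform" where
  "hyperbolic_form K 0 = QForm 0 (\<lambda>i j. \<zero>\<^bsub>K\<^esub>)"
| "hyperbolic_form K (Suc m) = orth_sum K (hyperbolic_plane K) (hyperbolic_form K m)"

text \<open>
  The Witt index is the number of hyperbolic planes in the Witt decomposition. It is meant for
  regular forms over fields of characteristic different from 2, where the number exists and is
  unique by Witt's theorems.
\<close>

definition witt_index :: "('a, 'b) ring_scheme \<Rightarrow> 'a qform \<Rightarrow> nat" where
  "witt_index K q = (THE m. \<exists>q_an. quadratic_form K q_an \<and> anisotropic K q_an \<and>
     isometric K q (orth_sum K (hyperbolic_form K m) q_an))"


section \<open>The local-global principle\<close>

definition base_change :: "('a, 'b) ring_scheme \<Rightarrow> ('a \<Rightarrow> int) \<Rightarrow> 'a qform \<Rightarrow> (nat \<Rightarrow> 'a) set qform" where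
  "base_change K v q = map_qform (completion_embed K v) q"

definition LGP :: "('a, 'b) ring_scheme \<Rightarrow> ('a \<Rightarrow> int) set \<Rightarrow> int \<Rightarrow> int \<Rightarrow> 'a qform \<Rightarrow> bool" where
  "LGP K V a b q \<longleftrightarrow>
     (\<forall>v \<in> V. int (witt_index (completion K v) (base_change K v q)) \<ge> a) \<longrightarrow>
     int (witt_index K q) \<ge> b"

end

theory Submission
  imports Defs
begin

text \<open>
  Adding \<open>m\<close> hyperbolic planes to a form raises all of its Witt indices, global and local, by \<open>m\<close>.
  For \<open>j < 0\<close> one applies the hypothesis to the sum of \<open>q\<close> and \<open>-j\<close> hyperbolic planes. For
  \<open>j > 0\<close> one goes up one step at a time: a form that is locally of Witt index at least \<open>r + 1\<close> has
  global Witt index at least \<open>s \<ge> 1\<close>, so a hyperbolic plane splits off over the base field, and the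
  inductive hypothesis applies to its complement. What has to be established is that the Witt index of
  a regular form exists and is unique over the base field and over its completions, and that base
  change preserves regularity and isometry. Witt cancellation is proved with reflections for
  one-dimensional summands and carried over to hyperbolic planes through
  \<open>H \<cong> \<langle>1\<rangle> \<bottom> \<langle>-1\<rangle>\<close>.
\<close>

section \<open>Linear maps and quadratic maps on padded vectors\<close>

text \<open>The two directions differ because a hyperbolic plane can always be added, but has to be
  found before it can be removed. Going up by j would mean removing j planes, while the hypothesis
  guarantees only s of them, possibly fewer than j. So the planes are found one at a time, each by
  the level of the principle already reached, and s >= 1 starts the process.

  Complements are the main obstacle: the complement of a vector is a subspace, whereas a form is a
  polynomial on coordinates. It is therefore parametrized by an explicit linear map, and the form is
  pulled back along that map; \<open>quadratic_map\<close> treats such pullbacks and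
  \<open>obtain_form\<close> gives them coefficients again. Over a completion a vector need not be
  the image of a vector over the base field, so identities cannot be transported pointwise. They are
  checked on unit vectors, which determine a linear map and, together with their polar values, a
  quadratic map. That 2 is invertible enters through B x x = 2 Q x, by which projections and
  reflections divide, and through the diagonal form of the hyperbolic plane.\<close>

lemma vecs_carrier: "cring R \<Longrightarrow> x \<in> vecs R n \<Longrightarrow> x i \<in> carrier R"
  unfolding vecs_def cring_def using ring.ring_simprules(2)[of R]
  by (cases "i < n") auto

lemma vecs_outside: "x \<in> vecs R n \<Longrightarrow> n \<le> i \<Longrightarrow> x i = \<zero>\<^bsub>R\<^esub>"
  by (auto simp: vecs_def)

definition linear_map ::
    "('a, 'b) ring_scheme \<Rightarrow> nat \<Rightarrow> nat \<Rightarrow> ((nat \<Rightarrow> 'a) \<Rightarrow> (nat \<Rightarrow> 'a)) \<Rightarrow> bool" where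
  "linear_map K m n f \<longleftrightarrow> f \<in> vecs K m \<rightarrow> vecs K n \<and>
     (\<forall>x \<in> vecs K m. \<forall>y \<in> vecs K m. f (vec_add K x y) = vec_add K (f x) (f y)) \<and>
     (\<forall>c \<in> carrier K. \<forall>x \<in> vecs K m. f (vec_smult K c x) = vec_smult K c (f x))"

lemma linear_iso_iff:
  "linear_iso K m n f \<longleftrightarrow> linear_map K m n f \<and> bij_betw f (vecs K m) (vecs K n)"
  unfolding linear_iso_def linear_map_def bij_betw_def by auto

definition unit_vec :: "('a, 'b) ring_scheme \<Rightarrow> nat \<Rightarrow> nat \<Rightarrow> 'a" where
  "unit_vec K i = (\<lambda>j. if j = i then \<one>\<^bsub>K\<^esub> else \<zero>\<^bsub>K\<^esub>)"

text \<open>Truncations stay in the ambient space, so an induction over the coordinates of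
  \<open>x\<close> runs inside a single \<open>vecs K n\<close>; \<open>vec_trunc_Suc\<close> is its
  step.\<close>

definition vec_trunc :: "('a, 'b) ring_scheme \<Rightarrow> nat \<Rightarrow> (nat \<Rightarrow> 'a) \<Rightarrow> nat \<Rightarrow> 'a" where
  "vec_trunc K m x = (\<lambda>i. if i < m then x i else \<zero>\<^bsub>K\<^esub>)"

text \<open>Together with \<open>vec_trunc\<close> and \<open>vec_drop\<close> this identifies the
  space of an orthogonal sum with the product of the spaces of its summands.\<close>

definition vec_append :: "nat \<Rightarrow> (nat \<Rightarrow> 'a) \<Rightarrow> (nat \<Rightarrow> 'a) \<Rightarrow> nat \<Rightarrow> 'a" where
  "vec_append m x y = (\<lambda>i. if i < m then x i else y (i - m))"

definition vec_drop :: "nat \<Rightarrow> (nat \<Rightarrow> 'a) \<Rightarrow> nat \<Rightarrow> 'a" where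
  "vec_drop m x = (\<lambda>i. x (m + i))"

text \<open>A quadratic map without chosen coefficients, so that pulling back along a linear map is
  plain composition. Linearity of \<open>B\<close> is asked on the left, and \<open>Q_add\<close>
  transfers it to the right by making \<open>B\<close> symmetric.\<close>

locale quadratic_map = cring R for R (structure) +
  fixes n :: nat and Q :: "(nat \<Rightarrow> 'a) \<Rightarrow> 'a" and B :: "(nat \<Rightarrow> 'a) \<Rightarrow> (nat \<Rightarrow> 'a) \<Rightarrow> 'a"
  assumes Q_closed [simp]: "x \<in> vecs R n \<Longrightarrow> Q x \<in> carrier R"
    and B_closed [simp]: "x \<in> vecs R n \<Longrightarrow> y \<in> vecs R n \<Longrightarrow> B x y \<in> carrier R"
    and Q_add: "x \<in> vecs R n \<Longrightarrow> y \<in> vecs R n \<Longrightarrow> Q (vec_add R x y) = Q x \<oplus> Q y \<oplus> B x y"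
    and Q_smult: "c \<in> carrier R \<Longrightarrow> x \<in> vecs R n \<Longrightarrow> Q (vec_smult R c x) = c \<otimes> c \<otimes> Q x"
    and B_add_left: "x \<in> vecs R n \<Longrightarrow> y \<in> vecs R n \<Longrightarrow> z \<in> vecs R n \<Longrightarrow>
      B (vec_add R x y) z = B x z \<oplus> B y z"
    and B_smult_left: "c \<in> carrier R \<Longrightarrow> x \<in> vecs R n \<Longrightarrow> z \<in> vecs R n \<Longrightarrow>
      B (vec_smult R c x) z = c \<otimes> B x z"

context cring
begin

lemma vec_add_closed [simp]:
  "x \<in> vecs R n \<Longrightarrow> y \<in> vecs R n \<Longrightarrow> vec_add R x y \<in> vecs R n"
  by (auto simp: vecs_def vec_add_def)

lemma vec_smult_closed [simp]:
  "c \<in> carrier R \<Longrightarrow> x \<in> vecs R n \<Longrightarrow> vec_smult R c x \<in> vecs R n"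
  by (auto simp: vecs_def vec_smult_def)

lemma vec_zero_closed [simp]: "vec_zero R \<in> vecs R n"
  by (auto simp: vecs_def vec_zero_def)

lemma unit_vec_closed [simp]: "i < n \<Longrightarrow> unit_vec R i \<in> vecs R n"
  by (auto simp: vecs_def unit_vec_def)

lemma vec_trunc_closed [simp]:
  assumes "x \<in> vecs R n" "m \<le> k"
  shows "vec_trunc R m x \<in> vecs R k"
  using assms vecs_carrier[OF is_cring assms(1)]
  by (auto simp: vecs_def vec_trunc_def)

lemma vec_trunc_closed' [simp]:
  assumes "x \<in> vecs R n"
  shows "vec_trunc R m x \<in> vecs R n"
  using assms vecs_carrier[OF is_cring assms(1)]
  by (auto simp: vecs_def vec_trunc_def)

lemma vec_trunc_id: "x \<in> vecs R n \<Longrightarrow> vec_trunc R n x = x"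
  by (auto simp: vecs_def vec_trunc_def)

lemma vec_trunc_0: "vec_trunc R 0 x = vec_zero R"
  by (auto simp: vec_zero_def vec_trunc_def)

lemma vec_trunc_Suc:
  assumes "x \<in> vecs R n"
  shows "vec_trunc R (Suc k) x = vec_add R (vec_trunc R k x) (vec_smult R (x k) (unit_vec R k))"
  using vecs_carrier[OF is_cring assms]
  by (auto simp: vec_trunc_def vec_add_def vec_smult_def unit_vec_def fun_eq_iff less_Suc_eq)

lemma vec_append_closed [simp]:
  "x \<in> vecs R m \<Longrightarrow> y \<in> vecs R n \<Longrightarrow> vec_append m x y \<in> vecs R (m + n)"
  by (auto simp: vecs_def vec_append_def)

lemma vec_drop_closed [simp]: "x \<in> vecs R (m + n) \<Longrightarrow> vec_drop m x \<in> vecs R n"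
  by (auto simp: vecs_def vec_drop_def)

lemma vec_append_trunc_drop [simp]: "vec_append m (vec_trunc R m x) (vec_drop m x) = x"
  by (auto simp: vec_append_def vec_trunc_def vec_drop_def)

lemma vec_trunc_append [simp]: "x \<in> vecs R m \<Longrightarrow> vec_trunc R m (vec_append m x y) = x"
  by (auto simp: vec_append_def vec_trunc_def vecs_def)

lemma vec_drop_append [simp]: "vec_drop m (vec_append m x y) = y"
  by (auto simp: vec_append_def vec_drop_def)

lemma vec_drop_add: "vec_drop m (vec_add R x y) = vec_add R (vec_drop m x) (vec_drop m y)"
  by (auto simp: vec_add_def vec_drop_def)

lemma vec_drop_smult: "vec_drop m (vec_smult R c x) = vec_smult R c (vec_drop m x)"
  by (auto simp: vec_smult_def vec_drop_def)

lemma vec_trunc_add: "vec_trunc R m (vec_add R x y) = vec_add R (vec_trunc R m x) (vec_trunc R m y)"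
  by (auto simp: vec_add_def vec_trunc_def)

lemma vec_trunc_smult:
  "c \<in> carrier R \<Longrightarrow> vec_trunc R m (vec_smult R c x) = vec_smult R c (vec_trunc R m x)"
  by (auto simp: vec_smult_def vec_trunc_def)

lemma vec_append_add:
  "vec_add R (vec_append m x y) (vec_append m x' y') = vec_append m (vec_add R x x') (vec_add R y y')"
  by (auto simp: vec_add_def vec_append_def)

lemma vec_append_smult:
  "vec_smult R c (vec_append m x y) = vec_append m (vec_smult R c x) (vec_smult R c y)"
  by (auto simp: vec_smult_def vec_append_def)

lemma vec_append_zero [simp]: "vec_append m (vec_zero R) (vec_zero R) = vec_zero R"
  by (auto simp: vec_zero_def vec_append_def)

lemma vec_smult_zero:
  assumes "x \<in> vecs R n"
  shows "vec_smult R \<zero> x = vec_zero R"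
  using assms vecs_carrier[OF is_cring assms(1)]
  by (auto simp: vec_zero_def vec_smult_def fun_eq_iff)

lemma vec_smult_one:
  assumes "x \<in> vecs R n"
  shows "vec_smult R \<one> x = x"
  using assms vecs_carrier[OF is_cring assms(1)]
  by (auto simp: vec_smult_def fun_eq_iff)

lemma vec_smult_smult:
  assumes "c \<in> carrier R" "d \<in> carrier R" "x \<in> vecs R n"
  shows "vec_smult R c (vec_smult R d x) = vec_smult R (c \<otimes> d) x"
  using assms vecs_carrier[OF is_cring assms(3)]
  by (auto simp: vec_smult_def fun_eq_iff m_assoc)

lemma vec_add_comm:
  assumes "x \<in> vecs R n" "y \<in> vecs R n"
  shows "vec_add R x y = vec_add R y x"
  using assms vecs_carrier[OF is_cring assms(1)] vecs_carrier[OF is_cring assms(2)]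
  by (auto simp: vec_add_def fun_eq_iff a_comm)

lemma vec_add_minus_cancel:
  assumes "x \<in> vecs R n" "w \<in> vecs R n" "c \<in> carrier R"
  shows "vec_add R (vec_add R x (vec_smult R c w)) (vec_smult R (\<ominus> c) w) = x"
  using assms vecs_carrier[OF is_cring assms(1)] vecs_carrier[OF is_cring assms(2)]
  by (simp add: vec_add_def vec_smult_def fun_eq_iff l_minus r_neg a_assoc)

lemma vec_add_zero [simp]:
  "x \<in> vecs R n \<Longrightarrow> vec_add R x (vec_zero R) = x"
  "x \<in> vecs R n \<Longrightarrow> vec_add R (vec_zero R) x = x"
  using vecs_carrier[OF is_cring] by (auto simp: vec_add_def vec_zero_def fun_eq_iff)

lemma add_add_minus_minus:
  assumes "a \<in> carrier R" "b \<in> carrier R" "c \<in> carrier R"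
  shows "a \<oplus> b \<oplus> c \<ominus> a \<ominus> b = c"
  using assms by algebra

lemma linear_map_closed [simp]: "linear_map R m n f \<Longrightarrow> x \<in> vecs R m \<Longrightarrow> f x \<in> vecs R n"
  by (auto simp: linear_map_def)

lemma linear_map_add:
  "linear_map R m n f \<Longrightarrow> x \<in> vecs R m \<Longrightarrow> y \<in> vecs R m \<Longrightarrow>
    f (vec_add R x y) = vec_add R (f x) (f y)"
  by (auto simp: linear_map_def)

lemma linear_map_smult:
  "linear_map R m n f \<Longrightarrow> c \<in> carrier R \<Longrightarrow> x \<in> vecs R m \<Longrightarrow>
    f (vec_smult R c x) = vec_smult R c (f x)"
  by (auto simp: linear_map_def)

lemma linear_map_zero: "linear_map R m n f \<Longrightarrow> f (vec_zero R) = vec_zero R"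
  using linear_map_smult[of m n f \<zero> "vec_zero R"] vec_smult_zero[of "vec_zero R" m]
    vec_smult_zero[of "f (vec_zero R)" n] by simp

lemma linear_map_comp:
  "linear_map R l m f \<Longrightarrow> linear_map R m n g \<Longrightarrow> linear_map R l n (g \<circ> f)"
  unfolding linear_map_def by (auto simp: Pi_iff)

lemma linear_map_id: "linear_map R n n (\<lambda>x. x)"
  unfolding linear_map_def by auto

text \<open>Serves over the completion, where a map extended from the base field is known only on
  unit vectors.\<close>

lemma linear_map_eq_on_basis:
  assumes f: "linear_map R m n f" and g: "linear_map R m n g"
    and eq: "\<And>i. i < m \<Longrightarrow> f (unit_vec R i) = g (unit_vec R i)" and x: "x \<in> vecs R m"
  shows "f x = g x"
proof -
  have "k \<le> m \<Longrightarrow> f (vec_trunc R k x) = g (vec_trunc R k x)" for k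
  proof (induction k)
    case 0
    then show ?case by (simp add: vec_trunc_0 linear_map_zero[OF f] linear_map_zero[OF g])
  next
    case (Suc k)
    then show ?case
      using x vecs_carrier[OF is_cring x]
      by (simp add: vec_trunc_Suc[OF x] linear_map_add[OF f] linear_map_add[OF g]
          linear_map_smult[OF f] linear_map_smult[OF g] eq)
  qed
  from this[of m] show ?thesis using x by (simp add: vec_trunc_id)
qed

lemma linear_iso_inverse:
  assumes "linear_iso R m n f"
  shows "linear_iso R n m (inv_into (vecs R m) f)"
proof -
  let ?g = "inv_into (vecs R m) f"
  have f: "linear_map R m n f" and b: "bij_betw f (vecs R m) (vecs R n)"
    using assms by (auto simp: linear_iso_iff)
  have fg: "f (?g y) = y" if "y \<in> vecs R n" for y
    using b that by (simp add: bij_betw_inv_into_right)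
  have gf: "?g (f x) = x" if "x \<in> vecs R m" for x
    using b that by (simp add: bij_betw_inv_into_left)
  have bg: "bij_betw ?g (vecs R n) (vecs R m)"
    using b by (rule bij_betw_inv_into)
  have g: "?g y \<in> vecs R m" if "y \<in> vecs R n" for y
    using bg that by (auto simp: bij_betw_def)
  have "?g (vec_add R x y) = vec_add R (?g x) (?g y)" if "x \<in> vecs R n" "y \<in> vecs R n" for x y
    using gf[of "vec_add R (?g x) (?g y)"] that g fg by (simp add: linear_map_add[OF f])
  moreover have "?g (vec_smult R c x) = vec_smult R c (?g x)" if "x \<in> vecs R n" "c \<in> carrier R" for c x
    using gf[of "vec_smult R c (?g x)"] that g fg by (simp add: linear_map_smult[OF f])
  ultimately show ?thesis
    using bg g by (auto simp: linear_iso_iff linear_map_def)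
qed

lemma linear_iso_comp:
  "linear_iso R l m f \<Longrightarrow> linear_iso R m n g \<Longrightarrow> linear_iso R l n (g \<circ> f)"
  unfolding linear_iso_iff using linear_map_comp bij_betw_trans by blast

lemma linear_isoI:
  assumes "linear_map R m n f" "g \<in> vecs R n \<rightarrow> vecs R m"
    "\<And>x. x \<in> vecs R m \<Longrightarrow> g (f x) = x" "\<And>y. y \<in> vecs R n \<Longrightarrow> f (g y) = y"
  shows "linear_iso R m n f"
  using assms unfolding linear_iso_iff
  by (auto intro!: bij_betw_byWitness[of _ g] simp: linear_map_def)

end

section \<open>Polar forms and the comparison of quadratic maps\<close>

context quadratic_map
begin

lemma B_commute: "x \<in> vecs R n \<Longrightarrow> y \<in> vecs R n \<Longrightarrow> B x y = B y x"
  using Q_add[of x y] Q_add[of y x] vec_add_comm[of x n y]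
  by (simp add: a_comm[of "Q y" "Q x"])

lemma B_add_right:
  "x \<in> vecs R n \<Longrightarrow> y \<in> vecs R n \<Longrightarrow> z \<in> vecs R n \<Longrightarrow> B z (vec_add R x y) = B z x \<oplus> B z y"
  using B_add_left[of x y z] B_commute[of z x] B_commute[of z y] B_commute[of z "vec_add R x y"]
  by simp

lemma B_smult_right:
  "c \<in> carrier R \<Longrightarrow> x \<in> vecs R n \<Longrightarrow> z \<in> vecs R n \<Longrightarrow> B z (vec_smult R c x) = c \<otimes> B z x"
  using B_smult_left[of c x z] B_commute[of z x] B_commute[of z "vec_smult R c x"] by simp

text \<open>Evaluating \<open>Q\<close> at x + x by \<open>Q_smult\<close> and by
  \<open>Q_add\<close> gives 4 Q x = 2 Q x + B x x. If 2 is invertible, a vector of nonzero value is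
  therefore not orthogonal to itself, which makes projections and reflections possible.\<close>

lemma B_self:
  assumes x: "x \<in> vecs R n"
  shows "B x x = (\<one> \<oplus> \<one>) \<otimes> Q x"
proof -
  have "vec_add R x x = vec_smult R (\<one> \<oplus> \<one>) x"
    using vecs_carrier[OF is_cring x] by (auto simp: vec_add_def vec_smult_def l_distr)
  then have "Q x \<oplus> Q x \<oplus> B x x = (\<one> \<oplus> \<one>) \<otimes> (\<one> \<oplus> \<one>) \<otimes> Q x"
    using Q_add[OF x x] Q_smult[of "\<one> \<oplus> \<one>" x] x by simp
  also have "\<dots> = Q x \<oplus> Q x \<oplus> (\<one> \<oplus> \<one>) \<otimes> Q x"
    using x by (simp add: l_distr a_assoc)
  finally show ?thesis using x by simp
qed

lemma Q_zero: "Q (vec_zero R) = \<zero>"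
  using Q_smult[of \<zero> "vec_zero R"] by (simp add: vec_smult_zero[of _ n])

lemma B_zero_left: "x \<in> vecs R n \<Longrightarrow> B (vec_zero R) x = \<zero>"
  using B_smult_left[of \<zero> "vec_zero R" x] by (simp add: vec_smult_zero[of _ n])

lemma B_polar: "x \<in> vecs R n \<Longrightarrow> y \<in> vecs R n \<Longrightarrow> B x y = Q (vec_add R x y) \<ominus> Q x \<ominus> Q y"
  using add_add_minus_minus[of "Q x" "Q y" "B x y"] by (simp add: Q_add)

lemma quadratic_map_comp:
  assumes f: "linear_map R m n f"
  shows "quadratic_map R m (Q \<circ> f) (\<lambda>x y. B (f x) (f y))"
  using linear_map_closed[OF f]
  by unfold_locales (simp_all add: linear_map_add[OF f] linear_map_smult[OF f] Q_add Q_smult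
      B_add_left B_smult_left)

end

text \<open>Rebuild \<open>x\<close> one coordinate at a time: a new coordinate contributes its
  square times the value at a unit vector, and a polar term with the truncation before it. Only
  pairs i < j occur, in keeping with the triangular coefficients of a form.\<close>

lemma quadratic_map_eqI:
  assumes "quadratic_map R n Q B" "quadratic_map R n Q' B'"
    and Q: "\<And>i. i < n \<Longrightarrow> Q (unit_vec R i) = Q' (unit_vec R i)"
    and B: "\<And>i j. i < j \<Longrightarrow> j < n \<Longrightarrow> B (unit_vec R i) (unit_vec R j) = B' (unit_vec R i) (unit_vec R j)"
    and x: "x \<in> vecs R n"
  shows "Q x = Q' x"
proof -
  interpret Q: quadratic_map R n Q B by fact
  interpret Q': quadratic_map R n Q' B' by fact
  note xc = vecs_carrier[OF Q.is_cring x]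
  \<comment> \<open>The truncation at \<open>l\<close> involves only unit vectors of index below
    \<open>l\<close>, hence below \<open>j\<close>, so linearity on the left reduces the claim to
    the given pairs.\<close>
  have BB: "l \<le> j \<Longrightarrow> j < n \<Longrightarrow>
      B (vec_trunc R l x) (unit_vec R j) = B' (vec_trunc R l x) (unit_vec R j)" for l j
  proof (induction l)
    case 0
    then show ?case by (simp add: Q.vec_trunc_0 Q.B_zero_left Q'.B_zero_left)
  next
    case (Suc l)
    then show ?case using x xc
      by (simp add: Q.vec_trunc_Suc[OF x] Q.B_add_left Q'.B_add_left Q.B_smult_left
          Q'.B_smult_left B)
  qed
  have "k \<le> n \<Longrightarrow> Q (vec_trunc R k x) = Q' (vec_trunc R k x)" for k
  proof (induction k)
    case 0
    then show ?case by (simp add: Q.vec_trunc_0 Q.Q_zero Q'.Q_zero)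
  next
    case (Suc k)
    then show ?case using x xc
      by (simp add: Q.vec_trunc_Suc[OF x] Q.Q_add Q'.Q_add Q.Q_smult Q'.Q_smult
          Q.B_smult_right Q'.B_smult_right Q BB)
  qed
  from this[of n] show ?thesis using x by (simp add: Q.vec_trunc_id)
qed

section \<open>Forms and quadratic maps\<close>

context cring
begin

text \<open>The summation pattern of \<open>qeval\<close> for an arbitrary summand; values and polar
  values of a form are both of this shape.\<close>

definition dsum :: "nat \<Rightarrow> (nat \<Rightarrow> nat \<Rightarrow> 'a) \<Rightarrow> 'a" where
  "dsum n F = (\<Oplus>j \<in> {..<n}. \<Oplus>i \<in> {..j}. F i j)"

lemma dsum_closed [simp]:
  assumes "\<And>i j. i \<le> j \<Longrightarrow> j < n \<Longrightarrow> F i j \<in> carrier R"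
  shows "dsum n F \<in> carrier R"
  unfolding dsum_def using assms by (auto intro!: finsum_closed)

lemma dsum_cong:
  assumes "\<And>i j. i \<le> j \<Longrightarrow> j < n \<Longrightarrow> G i j \<in> carrier R"
    and "\<And>i j. i \<le> j \<Longrightarrow> j < n \<Longrightarrow> F i j = G i j"
  shows "dsum n F = dsum n G"
  unfolding dsum_def
proof (rule finsum_cong'[OF refl])
  show "(\<lambda>j. \<Oplus>i \<in> {..j}. G i j) \<in> {..<n} \<rightarrow> carrier R"
    using assms(1) by (auto intro!: finsum_closed)
  show "(\<Oplus>i \<in> {..j}. F i j) = (\<Oplus>i \<in> {..j}. G i j)" if "j \<in> {..<n}" for j
    using assms that by (intro finsum_cong'[OF refl]) auto
qed

lemma dsum_add:
  assumes "\<And>i j. i \<le> j \<Longrightarrow> j < n \<Longrightarrow> F i j \<in> carrier R"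
    and "\<And>i j. i \<le> j \<Longrightarrow> j < n \<Longrightarrow> G i j \<in> carrier R"
  shows "dsum n (\<lambda>i j. F i j \<oplus> G i j) = dsum n F \<oplus> dsum n G"
proof -
  have "dsum n (\<lambda>i j. F i j \<oplus> G i j) = (\<Oplus>j \<in> {..<n}. (\<Oplus>i \<in> {..j}. F i j) \<oplus> (\<Oplus>i \<in> {..j}. G i j))"
    unfolding dsum_def using assms
    by (intro finsum_cong'[OF refl] finsum_addf) (auto intro!: finsum_closed a_closed)
  also have "\<dots> = dsum n F \<oplus> dsum n G"
    unfolding dsum_def using assms by (intro finsum_addf) (auto intro!: finsum_closed)
  finally show ?thesis .
qed

lemma dsum_mult:
  assumes "\<And>i j. i \<le> j \<Longrightarrow> j < n \<Longrightarrow> F i j \<in> carrier R" and c: "c \<in> carrier R"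
  shows "dsum n (\<lambda>i j. c \<otimes> F i j) = c \<otimes> dsum n F"
proof -
  have "dsum n (\<lambda>i j. c \<otimes> F i j) = (\<Oplus>j \<in> {..<n}. c \<otimes> (\<Oplus>i \<in> {..j}. F i j))"
    unfolding dsum_def using assms
    by (intro finsum_cong'[OF refl] finsum_rdistr[symmetric]) (auto intro!: finsum_closed m_closed)
  also have "\<dots> = c \<otimes> dsum n F"
    unfolding dsum_def using assms by (intro finsum_rdistr[symmetric]) (auto intro!: finsum_closed)
  finally show ?thesis .
qed

lemma dsum_0 [simp]: "dsum 0 F = \<zero>"
  by (simp add: dsum_def)

lemma dsum_Suc:
  assumes "\<And>i j. i \<le> j \<Longrightarrow> j < Suc n \<Longrightarrow> F i j \<in> carrier R"
  shows "dsum (Suc n) F = dsum n F \<oplus> (\<Oplus>i \<in> {..n}. F i n)"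
proof -
  have 1: "(\<lambda>j. \<Oplus>i \<in> {..j}. F i j) \<in> {..<n} \<rightarrow> carrier R"
    using assms by (auto intro!: finsum_closed)
  have 2: "(\<Oplus>i \<in> {..n}. F i n) \<in> carrier R"
    using assms by (auto intro!: finsum_closed)
  show ?thesis
    unfolding dsum_def lessThan_Suc using 1 2 by (simp add: a_comm)
qed

lemma dsum_single:
  assumes k: "k \<le> l" "l < n" and c: "F k l \<in> carrier R"
    and z: "\<And>i j. i \<le> j \<Longrightarrow> j < n \<Longrightarrow> (i, j) \<noteq> (k, l) \<Longrightarrow> F i j = \<zero>"
  shows "dsum n F = F k l"
proof -
  have inner: "(\<Oplus>i \<in> {..j}. F i j) = (if l = j then F k l else \<zero>)" if "j < n" for j
  proof -
    \<comment> \<open>For \<open>k > j\<close> the index \<open>k\<close> lies outside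
      \<open>{..j}\<close>; then \<open>k <= l\<close> excludes \<open>l = j\<close>, so
      \<open>w\<close> is zero and the formula still holds.\<close>
    define w where "w = (if l = j then F k l else \<zero>)"
    have w: "w \<in> carrier R" "\<not> k \<le> j \<Longrightarrow> w = \<zero>"
      using c k by (auto simp: w_def)
    have "(\<Oplus>i \<in> {..j}. F i j) = (\<Oplus>i \<in> {..j}. if k = i then w else \<zero>)"
      using z that w c by (intro finsum_cong'[OF refl]) (auto simp: w_def)
    also have "\<dots> = w"
      using finsum_singleton[of k "{..j}" "\<lambda>_. w"] w by (cases "k \<le> j") auto
    also note w_def
    finally show ?thesis .
  qed
  have "dsum n F = (\<Oplus>j \<in> {..<n}. if l = j then F k l else \<zero>)"
    unfolding dsum_def using inner c by (intro finsum_cong'[OF refl]) auto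
  also have "\<dots> = F k l"
    using finsum_singleton[of l "{..<n}" "\<lambda>j. F k l"] k c by auto
  finally show ?thesis .
qed

text \<open>The block shape of an orthogonal sum. The induction adds a column at a time: its first
  \<open>m\<close> entries are mixed and vanish, and the others form the new column of the second
  block.\<close>

lemma dsum_split:
  assumes "\<And>i j. i \<le> j \<Longrightarrow> j < m + n \<Longrightarrow> F i j \<in> carrier R"
    and "\<And>i j. i < m \<Longrightarrow> m \<le> j \<Longrightarrow> j < m + n \<Longrightarrow> F i j = \<zero>"
  shows "dsum (m + n) F = dsum m F \<oplus> dsum n (\<lambda>i j. F (m + i) (m + j))"
  using assms
proof (induction n)
  case 0
  then show ?case by simp
next
  case (Suc n)
  have "(\<Oplus>i \<in> {..m + n}. F i (m + n)) = (\<Oplus>i \<in> (+) m ` {..n}. F i (m + n))"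
  proof (rule add.finprod_mono_neutral_cong_right)
    show "F i (m + n) = \<zero>" if "i \<in> {..m + n} - (+) m ` {..n}" for i
    proof -
      have "i < m" using that
        by (auto simp: image_iff) (metis add_le_cancel_left atMost_iff le_Suc_ex not_less)
      then show ?thesis using Suc.prems(2) by simp
    qed
  qed (use Suc.prems in auto)
  also have "\<dots> = (\<Oplus>i \<in> {..n}. F (m + i) (m + n))"
    using Suc.prems by (intro finsum_reindex) auto
  finally have e: "(\<Oplus>i \<in> {..m + n}. F i (m + n)) = (\<Oplus>i \<in> {..n}. F (m + i) (m + n))" .
  have c: "(\<Oplus>i \<in> {..n}. F (m + i) (m + n)) \<in> carrier R"
    using Suc.prems by (auto intro!: finsum_closed)
  have "dsum (m + Suc n) F = dsum (m + n) F \<oplus> (\<Oplus>i \<in> {..n}. F (m + i) (m + n))"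
    using dsum_Suc[of "m + n" F] Suc.prems e by simp
  also have "dsum (m + n) F = dsum m F \<oplus> dsum n (\<lambda>i j. F (m + i) (m + j))"
    using Suc by simp
  finally show ?case
    using dsum_Suc[of n "\<lambda>i j. F (m + i) (m + j)"] Suc.prems c by (simp add: a_assoc)
qed

section \<open>The quadratic map of a form and its coefficients\<close>

lemma qeval_dsum: "qeval R q x = dsum (qdim q) (\<lambda>i j. qcoeff q i j \<otimes> x i \<otimes> x j)"
  by (simp add: qeval_def dsum_def)

lemma bilinear_expand:
  assumes "a \<in> carrier R" "x \<in> carrier R" "y \<in> carrier R" "x' \<in> carrier R" "y' \<in> carrier R"
  shows "a \<otimes> (x \<oplus> y) \<otimes> (x' \<oplus> y') = a \<otimes> x \<otimes> x' \<oplus> a \<otimes> y \<otimes> y' \<oplus> a \<otimes> (x \<otimes> y' \<oplus> y \<otimes> x')"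
  using assms by algebra

text \<open>The explicit symmetric sum makes bilinearity a termwise identity, which the definition
  of \<open>qpolar\<close> as a difference of values hides; \<open>qpolar_dsum\<close> then
  identifies the two.\<close>

lemma quadratic_map_dsum:
  assumes q: "quadratic_form R q"
  shows "quadratic_map R (qdim q) (qeval R q)
    (\<lambda>x y. dsum (qdim q) (\<lambda>i j. qcoeff q i j \<otimes> (x i \<otimes> y j \<oplus> y i \<otimes> x j)))"
proof -
  have qc: "qcoeff q i j \<in> carrier R" if "i \<le> j" "j < qdim q" for i j
    using q that by (auto simp: quadratic_form_def)
  note vc = vecs_carrier[OF is_cring]
  let ?n = "qdim q"
  let ?B = "\<lambda>x y. dsum (qdim q) (\<lambda>i j. qcoeff q i j \<otimes> (x i \<otimes> y j \<oplus> y i \<otimes> x j))"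
  show ?thesis
  proof unfold_locales
    fix x assume x: "x \<in> vecs R ?n"
    show "qeval R q x \<in> carrier R"
      unfolding qeval_dsum by (intro dsum_closed m_closed qc vc[OF x])
    show "qeval R q (vec_smult R c x) = c \<otimes> c \<otimes> qeval R q x" if c: "c \<in> carrier R" for c
    proof -
    have "qeval R q (vec_smult R c x) = dsum ?n (\<lambda>i j. (c \<otimes> c) \<otimes> (qcoeff q i j \<otimes> x i \<otimes> x j))"
      unfolding qeval_dsum
    proof (rule dsum_cong)
      show "qcoeff q i j \<otimes> vec_smult R c x i \<otimes> vec_smult R c x j
          = c \<otimes> c \<otimes> (qcoeff q i j \<otimes> x i \<otimes> x j)" if "i \<le> j" "j < ?n" for i j
        using qc[OF that] vc[OF x, of i] vc[OF x, of j] c unfolding vec_smult_def by algebra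
    qed (intro m_closed c qc vc[OF x])
    also have "\<dots> = c \<otimes> c \<otimes> qeval R q x"
      unfolding qeval_dsum by (intro dsum_mult m_closed c qc vc[OF x])
    finally show ?thesis .
    qed
    fix y assume y: "y \<in> vecs R ?n"
    show "?B x y \<in> carrier R"
      by (intro dsum_closed m_closed a_closed qc vc[OF x] vc[OF y])
    have "qeval R q (vec_add R x y) = dsum ?n (\<lambda>i j. qcoeff q i j \<otimes> x i \<otimes> x j \<oplus>
        qcoeff q i j \<otimes> y i \<otimes> y j \<oplus> qcoeff q i j \<otimes> (x i \<otimes> y j \<oplus> y i \<otimes> x j))"
      unfolding qeval_dsum vec_add_def
      by (intro dsum_cong bilinear_expand m_closed a_closed qc vc[OF x] vc[OF y])
    also have "\<dots> = dsum ?n (\<lambda>i j. qcoeff q i j \<otimes> x i \<otimes> x j \<oplus> qcoeff q i j \<otimes> y i \<otimes> y j) \<oplus> ?B x y"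
      by (intro dsum_add m_closed a_closed qc vc[OF x] vc[OF y])
    also have "dsum ?n (\<lambda>i j. qcoeff q i j \<otimes> x i \<otimes> x j \<oplus> qcoeff q i j \<otimes> y i \<otimes> y j)
        = qeval R q x \<oplus> qeval R q y"
      unfolding qeval_dsum by (intro dsum_add m_closed a_closed qc vc[OF x] vc[OF y])
    finally show "qeval R q (vec_add R x y) = qeval R q x \<oplus> qeval R q y \<oplus> ?B x y" .
    show "?B (vec_smult R c x) y = c \<otimes> ?B x y" if c: "c \<in> carrier R" for c
    proof -
    have "?B (vec_smult R c x) y = dsum ?n (\<lambda>i j. c \<otimes> (qcoeff q i j \<otimes> (x i \<otimes> y j \<oplus> y i \<otimes> x j)))"
    proof (rule dsum_cong)
      show "qcoeff q i j \<otimes> (vec_smult R c x i \<otimes> y j \<oplus> y i \<otimes> vec_smult R c x j)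
          = c \<otimes> (qcoeff q i j \<otimes> (x i \<otimes> y j \<oplus> y i \<otimes> x j))" if "i \<le> j" "j < ?n" for i j
        using qc[OF that] vc[OF x, of i] vc[OF x, of j] vc[OF y, of i] vc[OF y, of j] c
        unfolding vec_smult_def by algebra
    qed (intro m_closed a_closed c qc vc[OF x] vc[OF y])
    also have "\<dots> = c \<otimes> ?B x y"
      by (intro dsum_mult m_closed a_closed c qc vc[OF x] vc[OF y])
    finally show ?thesis .
    qed
    fix z assume z: "z \<in> vecs R ?n"
    have "?B (vec_add R x y) z = dsum ?n (\<lambda>i j. qcoeff q i j \<otimes> (x i \<otimes> z j \<oplus> z i \<otimes> x j)
        \<oplus> qcoeff q i j \<otimes> (y i \<otimes> z j \<oplus> z i \<otimes> y j))"
    proof (rule dsum_cong)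
      show "qcoeff q i j \<otimes> (vec_add R x y i \<otimes> z j \<oplus> z i \<otimes> vec_add R x y j)
          = qcoeff q i j \<otimes> (x i \<otimes> z j \<oplus> z i \<otimes> x j)
        \<oplus> qcoeff q i j \<otimes> (y i \<otimes> z j \<oplus> z i \<otimes> y j)" if "i \<le> j" "j < ?n" for i j
        using qc[OF that] vc[OF x, of i] vc[OF x, of j] vc[OF y, of i] vc[OF y, of j]
          vc[OF z, of i] vc[OF z, of j]
        unfolding vec_add_def by algebra
    qed (intro m_closed a_closed qc vc[OF x] vc[OF y] vc[OF z])
    also have "\<dots> = ?B x z \<oplus> ?B y z"
      by (intro dsum_add m_closed a_closed qc vc[OF x] vc[OF y] vc[OF z])
    finally show "?B (vec_add R x y) z = ?B x z \<oplus> ?B y z" .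
  qed
qed

lemma qpolar_dsum:
  assumes q: "quadratic_form R q" and xy: "x \<in> vecs R (qdim q)" "y \<in> vecs R (qdim q)"
  shows "qpolar R q x y = dsum (qdim q) (\<lambda>i j. qcoeff q i j \<otimes> (x i \<otimes> y j \<oplus> y i \<otimes> x j))"
  using quadratic_map.B_polar[OF quadratic_map_dsum[OF q] xy] by (simp add: qpolar_def)

lemma quadratic_map_qeval:
  assumes q: "quadratic_form R q"
  shows "quadratic_map R (qdim q) (qeval R q) (qpolar R q)"
proof -
  interpret Q: quadratic_map R "qdim q" "qeval R q"
    "\<lambda>x y. dsum (qdim q) (\<lambda>i j. qcoeff q i j \<otimes> (x i \<otimes> y j \<oplus> y i \<otimes> x j))"
    by (rule quadratic_map_dsum[OF q])
  note [simp] = qpolar_dsum[OF q]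
  show ?thesis
    by unfold_locales (simp_all add: Q.Q_add Q.Q_smult Q.B_add_left Q.B_smult_left)
qed

lemma qeval_unit_vec:
  assumes q: "quadratic_form R q" and k: "k < qdim q"
  shows "qeval R q (unit_vec R k) = qcoeff q k k"
proof -
  have qc: "qcoeff q i j \<in> carrier R" if "i \<le> j" "j < qdim q" for i j
    using q that by (auto simp: quadratic_form_def)
  have "qeval R q (unit_vec R k) = qcoeff q k k \<otimes> unit_vec R k k \<otimes> unit_vec R k k"
    unfolding qeval_dsum using k qc by (intro dsum_single) (auto simp: unit_vec_def)
  then show ?thesis using qc k by (simp add: unit_vec_def)
qed

lemma qpolar_unit_vec:
  assumes q: "quadratic_form R q" and k: "k < l" "l < qdim q"
  shows "qpolar R q (unit_vec R k) (unit_vec R l) = qcoeff q k l"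
proof -
  have qc: "qcoeff q i j \<in> carrier R" if "i \<le> j" "j < qdim q" for i j
    using q that by (auto simp: quadratic_form_def)
  have "qpolar R q (unit_vec R k) (unit_vec R l)
      = qcoeff q k l \<otimes> (unit_vec R k k \<otimes> unit_vec R l l \<oplus> unit_vec R l k \<otimes> unit_vec R k l)"
    unfolding qpolar_dsum[OF q unit_vec_closed unit_vec_closed, OF less_trans[OF k] k(2)]
    using k qc by (intro dsum_single) (auto simp: unit_vec_def)
  then show ?thesis using qc k by (simp add: unit_vec_def)
qed

end

text \<open>The diagonal coefficients have to be the values at unit vectors and the others their
  polar values; \<open>quadratic_map_eqI\<close> shows that these suffice. This turns a form
  restricted to a parametrized complement into a \<open>qform\<close>.\<close>

lemma (in quadratic_map) obtain_form:
  obtains q where "quadratic_form R q" "qdim q = n" "\<And>x. x \<in> vecs R n \<Longrightarrow> qeval R q x = Q x"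
proof -
  let ?q = "QForm n (\<lambda>i j. if i = j then Q (unit_vec R i) else B (unit_vec R i) (unit_vec R j))"
  have q: "quadratic_form R ?q" by (auto simp: quadratic_form_def)
  have "qeval R ?q x = Q x" if "x \<in> vecs R n" for x
    using qeval_unit_vec[OF q] qpolar_unit_vec[OF q]
    by (intro quadratic_map_eqI[OF quadratic_map_qeval[OF q, simplified] quadratic_map_axioms _ _ that])
      auto
  then show ?thesis using that[of ?q] q by auto
qed

section \<open>Isometries and orthogonal sums\<close>

definition isometry ::
    "('a, 'b) ring_scheme \<Rightarrow> 'a qform \<Rightarrow> 'a qform \<Rightarrow> ((nat \<Rightarrow> 'a) \<Rightarrow> (nat \<Rightarrow> 'a)) \<Rightarrow> bool" where
  "isometry K q q' f \<longleftrightarrow> linear_iso K (qdim q) (qdim q') f \<and>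
     (\<forall>x \<in> vecs K (qdim q). qeval K q' (f x) = qeval K q x)"

lemma isometric_iff: "isometric K q q' \<longleftrightarrow> (\<exists>f. isometry K q q' f)"
  by (simp add: isometric_def isometry_def)

text \<open>The form <a>. With a constant coefficient function its base change is
  \<open>unary_form (\<phi> a)\<close> as an equality of forms.\<close>

definition unary_form :: "'a \<Rightarrow> 'a qform" where
  "unary_form a = QForm 1 (\<lambda>i j. a)"

lemma qdim_unary [simp]: "qdim (unary_form a) = 1"
  by (simp add: unary_form_def)

lemma quadratic_form_unary [simp]: "a \<in> carrier R \<Longrightarrow> quadratic_form R (unary_form a)"
  by (simp add: unary_form_def quadratic_form_def)

lemma qdim_orth_sum [simp]: "qdim (orth_sum K q q') = qdim q + qdim q'"
  by (simp add: orth_sum_def)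

text \<open>An equality of forms and not merely an isometry, since even the irrelevant coefficients
  agree; sums can thus be rebracketed by rewriting.\<close>

lemma orth_sum_assoc: "orth_sum K (orth_sum K p q) r = orth_sum K p (orth_sum K q r)"
  by (auto simp: orth_sum_def fun_eq_iff intro: arg_cong2[where f = "qcoeff r"])

lemma orth_sum_hyperbolic_0 [simp]: "orth_sum K (hyperbolic_form K 0) q = q"
  by (cases q) (simp add: orth_sum_def)

context cring
begin

lemma quadratic_form_orth_sum [simp]:
  assumes "quadratic_form R q" "quadratic_form R q'"
  shows "quadratic_form R (orth_sum R q q')"
  using assms by (auto simp: quadratic_form_def orth_sum_def diff_le_mono less_diff_conv2)

lemma quadratic_form_hyperbolic_plane [simp]: "quadratic_form R (hyperbolic_plane R)"
  by (auto simp: quadratic_form_def hyperbolic_plane_def)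

lemma quadratic_form_hyperbolic_form [simp]: "quadratic_form R (hyperbolic_form R m)"
  by (induction m) (simp_all add: quadratic_form_def[of R "QForm 0 _"])

lemma qeval_unary:
  "a \<in> carrier R \<Longrightarrow> x \<in> vecs R 1 \<Longrightarrow> qeval R (unary_form a) x = a \<otimes> x 0 \<otimes> x 0"
  using vecs_carrier[OF is_cring, of x 1 0]
  by (simp add: qeval_dsum unary_form_def dsum_Suc[of 0, simplified])

lemma qeval_orth_sum:
  assumes q: "quadratic_form R q" and q': "quadratic_form R q'"
    and w: "w \<in> vecs R (qdim q + qdim q')"
  shows "qeval R (orth_sum R q q') w
    = qeval R q (vec_trunc R (qdim q) w) \<oplus> qeval R q' (vec_drop (qdim q) w)"
proof -
  note vc = vecs_carrier[OF is_cring w]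
  have qc: "qcoeff q i j \<in> carrier R" if "i \<le> j" "j < qdim q" for i j
    using q that by (auto simp: quadratic_form_def)
  have qc': "qcoeff q' i j \<in> carrier R" if "i \<le> j" "j < qdim q'" for i j
    using q' that by (auto simp: quadratic_form_def)
  have c: "qcoeff (orth_sum R q q') i j \<in> carrier R" if "i \<le> j" "j < qdim q + qdim q'" for i j
    using quadratic_form_orth_sum[OF q q'] that by (auto simp: quadratic_form_def)
  have "qeval R (orth_sum R q q') w
    = dsum (qdim q) (\<lambda>i j. qcoeff (orth_sum R q q') i j \<otimes> w i \<otimes> w j)
    \<oplus> dsum (qdim q') (\<lambda>i j. qcoeff (orth_sum R q q') (qdim q + i) (qdim q + j)
        \<otimes> w (qdim q + i) \<otimes> w (qdim q + j))"
    unfolding qeval_dsum qdim_orth_sum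
  proof (rule dsum_split)
    show "qcoeff (orth_sum R q q') i j \<otimes> w i \<otimes> w j = \<zero>"
      if "i < qdim q" "qdim q \<le> j" "j < qdim q + qdim q'" for i j
      using that vc by (simp add: orth_sum_def)
  qed (intro m_closed c vc)
  also have "dsum (qdim q) (\<lambda>i j. qcoeff (orth_sum R q q') i j \<otimes> w i \<otimes> w j)
      = qeval R q (vec_trunc R (qdim q) w)"
    unfolding qeval_dsum using qc vc
    by (intro dsum_cong m_closed qc) (auto simp: orth_sum_def vec_trunc_def)
  also have "dsum (qdim q') (\<lambda>i j. qcoeff (orth_sum R q q') (qdim q + i) (qdim q + j)
        \<otimes> w (qdim q + i) \<otimes> w (qdim q + j)) = qeval R q' (vec_drop (qdim q) w)"
    unfolding qeval_dsum using qc' vc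
    by (intro dsum_cong m_closed qc') (auto simp: orth_sum_def vec_drop_def)
  finally show ?thesis .
qed

lemma sum_polar_identity:
  assumes "a \<in> carrier R" "b \<in> carrier R" "c \<in> carrier R" "d \<in> carrier R" "e \<in> carrier R" "f \<in> carrier R"
  shows "(a \<oplus> b) \<ominus> (c \<oplus> d) \<ominus> (e \<oplus> f) = (a \<ominus> c \<ominus> e) \<oplus> (b \<ominus> d \<ominus> f)"
  using assms by algebra

lemma qpolar_orth_sum:
  assumes q: "quadratic_form R q" and q': "quadratic_form R q'"
    and w: "w \<in> vecs R (qdim q + qdim q')" "z \<in> vecs R (qdim q + qdim q')"
  shows "qpolar R (orth_sum R q q') w z
    = qpolar R q (vec_trunc R (qdim q) w) (vec_trunc R (qdim q) z)
      \<oplus> qpolar R q' (vec_drop (qdim q) w) (vec_drop (qdim q) z)"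
proof -
  interpret Q: quadratic_map R "qdim q" "qeval R q" "qpolar R q"
    by (rule quadratic_map_qeval[OF q])
  interpret Q': quadratic_map R "qdim q'" "qeval R q'" "qpolar R q'"
    by (rule quadratic_map_qeval[OF q'])
  note [simp] = vec_trunc_closed[OF w(1), of "qdim q" "qdim q"] vec_trunc_closed[OF w(2), of "qdim q" "qdim q"]
  note [simp] = vec_drop_closed[OF w(1)] vec_drop_closed[OF w(2)]
  show ?thesis
    unfolding qpolar_def
      qeval_orth_sum[OF q q' w(1)] qeval_orth_sum[OF q q' w(2)]
      qeval_orth_sum[OF q q' vec_add_closed[OF w]] vec_trunc_add vec_drop_add
    by (rule sum_polar_identity) simp_all
qed

lemma isometryD:
  assumes "isometry R q q' f"
  shows "linear_map R (qdim q) (qdim q') f" "bij_betw f (vecs R (qdim q)) (vecs R (qdim q'))"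
    "\<And>x. x \<in> vecs R (qdim q) \<Longrightarrow> qeval R q' (f x) = qeval R q x"
  using assms by (auto simp: isometry_def linear_iso_iff)

lemma isometry_inverse:
  assumes f: "isometry R q q' f"
  shows "isometry R q' q (inv_into (vecs R (qdim q)) f)"
proof -
  let ?g = "inv_into (vecs R (qdim q)) f"
  have g: "linear_iso R (qdim q') (qdim q) ?g"
    using f by (auto simp: isometry_def intro: linear_iso_inverse)
  have "qeval R q (?g y) = qeval R q' y" if "y \<in> vecs R (qdim q')" for y
  proof -
    have "?g y \<in> vecs R (qdim q)" using g that by (auto simp: linear_iso_iff)
    then show ?thesis
      using isometryD(3)[OF f, of "?g y"] bij_betw_inv_into_right[OF isometryD(2)[OF f] that] by simp
  qed
  with g show ?thesis by (simp add: isometry_def)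
qed

lemma isometry_comp:
  assumes "isometry R p q f" "isometry R q r g"
  shows "isometry R p r (g \<circ> f)"
  using assms linear_iso_comp[of "qdim p" "qdim q" f "qdim r" g] isometryD(1)[OF assms(1)]
  by (auto simp: isometry_def)

lemma isometry_polar:
  assumes f: "isometry R q q' f" and x: "x \<in> vecs R (qdim q)" "y \<in> vecs R (qdim q)"
  shows "qpolar R q' (f x) (f y) = qpolar R q x y"
  unfolding qpolar_def linear_map_add[OF isometryD(1)[OF f] x, symmetric]
  using x by (simp add: isometryD(3)[OF f])

lemma isometric_refl: "isometric R q q"
  by (auto simp: isometric_def linear_iso_iff linear_map_id intro!: exI[of _ "\<lambda>x. x"] bij_betw_id[unfolded id_def])

lemma isometric_sym: "isometric R q q' \<Longrightarrow> isometric R q' q"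
  unfolding isometric_iff using isometry_inverse by blast

lemma isometric_trans [trans]: "isometric R p q \<Longrightarrow> isometric R q r \<Longrightarrow> isometric R p r"
  unfolding isometric_iff using isometry_comp by blast

lemma isometric_orth_sum:
  assumes qf: "quadratic_form R p" "quadratic_form R p'" "quadratic_form R q" "quadratic_form R q'"
    and iso: "isometric R p p'" "isometric R q q'"
  shows "isometric R (orth_sum R p q) (orth_sum R p' q')"
proof -
  obtain f g where f: "isometry R p p' f" and g: "isometry R q q' g"
    using iso by (auto simp: isometric_iff)
  let ?m = "qdim p" and ?m' = "qdim p'" and ?n = "qdim q" and ?n' = "qdim q'"
  let ?h = "\<lambda>f g m n w. vec_append n (f (vec_trunc R m w)) (g (vec_drop m w))"
  note fD = isometryD[OF f] and gD = isometryD[OF g]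
  note f'D = isometryD[OF isometry_inverse[OF f]] and g'D = isometryD[OF isometry_inverse[OF g]]
  have c [simp]: "vec_trunc R m w \<in> vecs R m" "vec_drop m w \<in> vecs R n" if "w \<in> vecs R (m + n)" for w m n
    using that by auto
  have lin: "linear_map R (?m + ?n) (?m' + ?n') (?h f g ?m ?m')"
    unfolding linear_map_def
    by (auto simp: vec_trunc_add vec_drop_add vec_trunc_smult vec_drop_smult vec_append_add
        vec_append_smult linear_map_add[OF fD(1)] linear_map_add[OF gD(1)]
        linear_map_smult[OF fD(1)] linear_map_smult[OF gD(1)] linear_map_closed[OF fD(1)]
        linear_map_closed[OF gD(1)])
  have "linear_iso R (?m + ?n) (?m' + ?n') (?h f g ?m ?m')"
  proof (rule linear_isoI[OF lin])
    let ?f' = "inv_into (vecs R ?m) f" and ?g' = "inv_into (vecs R ?n) g"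
    show "?h ?f' ?g' ?m' ?m \<in> vecs R (?m' + ?n') \<rightarrow> vecs R (?m + ?n)"
      by (auto simp: linear_map_closed[OF f'D(1)] linear_map_closed[OF g'D(1)])
    show "?h ?f' ?g' ?m' ?m (?h f g ?m ?m' w) = w" if "w \<in> vecs R (?m + ?n)" for w
      using that by (simp add: linear_map_closed[OF fD(1)] bij_betw_inv_into_left[OF fD(2)]
          bij_betw_inv_into_left[OF gD(2)])
    show "?h f g ?m ?m' (?h ?f' ?g' ?m' ?m w) = w" if "w \<in> vecs R (?m' + ?n')" for w
      using that by (simp add: linear_map_closed[OF f'D(1)] bij_betw_inv_into_right[OF fD(2)]
          bij_betw_inv_into_right[OF gD(2)])
  qed
  moreover have "qeval R (orth_sum R p' q') (?h f g ?m ?m' w) = qeval R (orth_sum R p q) w"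
    if w: "w \<in> vecs R (?m + ?n)" for w
    using w
      by (simp add: qeval_orth_sum qf linear_map_closed[OF fD(1)] linear_map_closed[OF gD(1)] fD(3) gD(3))
  ultimately show ?thesis
    unfolding isometric_def qdim_orth_sum by blast
qed

section \<open>Regularity under isometry and orthogonal sums\<close>

lemma regular_formD: "regular_form R q \<Longrightarrow> quadratic_form R q"
  by (simp add: regular_form_def)

lemma regular_isometric:
  assumes r: "regular_form R q" and q': "quadratic_form R q'" and iso: "isometric R q q'"
  shows "regular_form R q'"
  unfolding regular_form_def
proof (intro conjI ballI impI)
  obtain f where f: "isometry R q' q f"
    using isometric_sym[OF iso] by (auto simp: isometric_iff)
  note fD = isometryD[OF f]
  show "quadratic_form R q'" by fact
  fix x assume x: "x \<in> vecs R (qdim q')" and 0: "\<forall>y \<in> vecs R (qdim q'). qpolar R q' x y = \<zero>"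
  have "qpolar R q (f x) z = \<zero>" if z: "z \<in> vecs R (qdim q)" for z
  proof -
    obtain y where "y \<in> vecs R (qdim q')" "z = f y"
      using fD(2) z by (auto simp: bij_betw_def)
    then show ?thesis using isometry_polar[OF f x] 0 by simp
  qed
  then have "f x = vec_zero R"
    using r linear_map_closed[OF fD(1) x] by (auto simp: regular_form_def)
  then have "f x = f (vec_zero R)" by (simp add: linear_map_zero[OF fD(1)])
  then show "x = vec_zero R"
    using fD(2) x vec_zero_closed[of "qdim q'"] by (auto simp: bij_betw_def inj_on_def)
qed

text \<open>The radical of the sum is the product of the two radicals, as one sees by testing
  against vectors that vanish in one block. Read from left to right, this makes the complement of a
  split summand regular.\<close>

lemma regular_orth_sum_iff:
  assumes q: "quadratic_form R q" and q': "quadratic_form R q'"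
  shows "regular_form R (orth_sum R q q') \<longleftrightarrow> regular_form R q \<and> regular_form R q'"
proof -
  interpret Q: quadratic_map R "qdim q" "qeval R q" "qpolar R q"
    by (rule quadratic_map_qeval[OF q])
  interpret Q': quadratic_map R "qdim q'" "qeval R q'" "qpolar R q'"
    by (rule quadratic_map_qeval[OF q'])
  let ?m = "qdim q" and ?n = "qdim q'"
  have c [simp]: "vec_trunc R ?m w \<in> vecs R ?m" "vec_drop ?m w \<in> vecs R ?n" if "w \<in> vecs R (?m + ?n)" for w
    using that by auto
  have polar: "qpolar R (orth_sum R q q') (vec_append ?m x y) z
      = qpolar R q x (vec_trunc R ?m z) \<oplus> qpolar R q' y (vec_drop ?m z)"
    if "x \<in> vecs R ?m" "y \<in> vecs R ?n" "z \<in> vecs R (?m + ?n)" for x y z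
    using that by (simp add: qpolar_orth_sum q q')
  show ?thesis
  proof (intro iffI conjI)
    assume r: "regular_form R (orth_sum R q q')"
    have zero: "vec_append ?m x y = vec_zero R"
      if "x \<in> vecs R ?m" "y \<in> vecs R ?n" "\<And>z. z \<in> vecs R ?m \<Longrightarrow> qpolar R q x z = \<zero>"
        "\<And>z. z \<in> vecs R ?n \<Longrightarrow> qpolar R q' y z = \<zero>" for x y
      using r that by (auto simp: regular_form_def polar)
    show "regular_form R q"
      unfolding regular_form_def
    proof (intro conjI ballI impI q)
      fix x assume x: "x \<in> vecs R ?m" "\<forall>y \<in> vecs R ?m. qpolar R q x y = \<zero>"
      have "vec_append ?m x (vec_zero R) = vec_zero R"
        using x by (intro zero) (auto simp: Q'.B_zero_left)
      then show "x = vec_zero R"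
        using vec_trunc_append[OF x(1), of "vec_zero R"] by (simp add: vec_trunc_def vec_zero_def)
    qed
    show "regular_form R q'"
      unfolding regular_form_def
    proof (intro conjI ballI impI q')
      fix x assume x: "x \<in> vecs R ?n" "\<forall>y \<in> vecs R ?n. qpolar R q' x y = \<zero>"
      have "vec_append ?m (vec_zero R) x = vec_zero R"
        using x by (intro zero) (auto simp: Q.B_zero_left)
      then show "x = vec_zero R"
        using vec_drop_append[of ?m "vec_zero R" x] by (simp add: vec_drop_def vec_zero_def)
    qed
  next
    assume r: "regular_form R q \<and> regular_form R q'"
    show "regular_form R (orth_sum R q q')"
      unfolding regular_form_def qdim_orth_sum
    proof (intro conjI ballI impI quadratic_form_orth_sum q q')
      fix w assume w: "w \<in> vecs R (?m + ?n)"
        and 0: "\<forall>z \<in> vecs R (?m + ?n). qpolar R (orth_sum R q q') w z = \<zero>"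
      let ?x = "vec_trunc R ?m w" and ?y = "vec_drop ?m w"
      have p: "qpolar R q ?x a \<oplus> qpolar R q' ?y b = \<zero>" if "a \<in> vecs R ?m" "b \<in> vecs R ?n" for a b
        using 0 polar[of ?x ?y "vec_append ?m a b"] w that by simp
      have "qpolar R q ?x a = \<zero>" if "a \<in> vecs R ?m" for a
        using p[OF that vec_zero_closed] w that
          by (simp add: Q'.B_commute[of _ "vec_zero R"] Q'.B_zero_left)
      then have x: "?x = vec_zero R"
        using r w by (auto simp: regular_form_def)
      have "qpolar R q' ?y b = \<zero>" if "b \<in> vecs R ?n" for b
        using p[OF vec_zero_closed that] w that
          by (simp add: Q.B_commute[of _ "vec_zero R"] Q.B_zero_left)
      then have y: "?y = vec_zero R"
        using r w by (auto simp: regular_form_def)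
      show "w = vec_zero R"
        using vec_append_trunc_drop[of ?m w] x y by simp
    qed
  qed
qed

end

section \<open>Witt cancellation\<close>

locale field_char_not_2 = field R for R (structure) +
  assumes two_nonzero: "\<one> \<oplus> \<one> \<noteq> \<zero>"

section \<open>One-dimensional summands: splitting, moving and cancelling\<close>

context field_char_not_2
begin

lemma inv_nonzero: "a \<in> carrier R \<Longrightarrow> a \<noteq> \<zero> \<Longrightarrow> inv a \<in> carrier R \<and> a \<otimes> inv a = \<one> \<and> inv a \<otimes> a = \<one>"
  using field_Units by auto

lemma double_nonzero: "a \<in> carrier R \<Longrightarrow> a \<noteq> \<zero> \<Longrightarrow> (\<one> \<oplus> \<one>) \<otimes> a \<noteq> \<zero>"
  using two_nonzero integral by blast

lemma qeval_unary_unit_vec: "a \<in> carrier R \<Longrightarrow> qeval R (unary_form a) (unit_vec R 0) = a"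
  using qeval_unary[of a "unit_vec R 0"] unit_vec_closed[of 0 1] by (simp add: unit_vec_def)

lemma isometry_unary_I:
  assumes f: "linear_iso R (Suc (qdim q')) (qdim q) f"
    and q: "quadratic_form R q" "quadratic_form R q'" and a: "a \<in> carrier R"
    and eq: "\<And>w. w \<in> vecs R (Suc (qdim q')) \<Longrightarrow>
      qeval R q (f w) = a \<otimes> w 0 \<otimes> w 0 \<oplus> qeval R q' (vec_drop 1 w)"
  shows "isometry R (orth_sum R (unary_form a) q') q f"
proof -
  have "qeval R q (f w) = qeval R (orth_sum R (unary_form a) q') w" if w: "w \<in> vecs R (Suc (qdim q'))" for w
    using w eq[OF w] q a
    by (simp add: qeval_orth_sum qeval_unary[unfolded One_nat_def]) (simp add: vec_trunc_def)
  then show ?thesis using f by (simp add: isometry_def)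
qed

text \<open>
  The isometry sends \<open>(c, y)\<close> to \<open>c x + P (ins y)\<close>, where \<open>ins\<close> inserts \<open>0\<close> at a position \<open>i\<close> with
  \<open>x i \<noteq> 0\<close> and \<open>P\<close> is the orthogonal projection along \<open>x\<close>.
\<close>

lemma split_unary:
  assumes q: "quadratic_form R q" and x: "x \<in> vecs R (qdim q)"
    and a: "qeval R q x = a" "a \<noteq> \<zero>"
  obtains q' f where "quadratic_form R q'" "qdim q = Suc (qdim q')"
    "isometry R (orth_sum R (unary_form a) q') q f" "f (unit_vec R 0) = x"
proof -
  let ?n = "qdim q"
  interpret Q: quadratic_map R ?n "qeval R q" "qpolar R q"
    by (rule quadratic_map_qeval[OF q])
  note vc = vecs_carrier[OF is_cring]
  note xc = vc[OF x]
  have ac: "a \<in> carrier R" using a(1) x by auto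
  have "x \<noteq> vec_zero R" using a Q.Q_zero by auto
  then obtain i where i: "x i \<noteq> \<zero>" by (auto simp: vec_zero_def fun_eq_iff)
  then have in': "i < ?n" using vecs_outside[OF x, of i] by (cases "i < ?n") auto
  then obtain n' where n: "?n = Suc n'" by (cases ?n) auto
  \<comment> \<open>By \<open>B_self\<close>, 2 a is the polar value of \<open>x\<close> with
    itself, so \<open>c z\<close> below is the coefficient of the projection of \<open>z\<close>
    onto the line of \<open>x\<close>.\<close>
  define t where "t = inv ((\<one> \<oplus> \<one>) \<otimes> a)"
  have t: "t \<in> carrier R" "((\<one> \<oplus> \<one>) \<otimes> a) \<otimes> t = \<one>"
    using inv_nonzero[OF _ double_nonzero[OF ac a(2)]] ac by (auto simp: t_def)
  have Bxx: "qpolar R q x x = (\<one> \<oplus> \<one>) \<otimes> a" using Q.B_self[OF x] a by simp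
  define c where "c = (\<lambda>z. qpolar R q z x \<otimes> t)"
  have cc [simp]: "c z \<in> carrier R" if "z \<in> vecs R ?n" for z
    using that x t by (simp add: c_def)
  define P where "P = (\<lambda>z. vec_add R z (vec_smult R (\<ominus> c z) x))"
  define ins where "ins = (\<lambda>y j. if j < i then y j else if j = i then \<zero> else (y (j - 1) :: 'a))"
  define del where "del = (\<lambda>z j. if j < i then z j else (z (Suc j) :: 'a))"
  have linP: "linear_map R ?n ?n P"
    unfolding linear_map_def
  proof (intro conjI ballI)
    show "P \<in> vecs R ?n \<rightarrow> vecs R ?n" using x by (auto simp: P_def)
    fix y z assume yz: "y \<in> vecs R ?n" "z \<in> vecs R ?n"
    have "c (vec_add R y z) = c y \<oplus> c z"
      using yz x t by (simp add: c_def Q.B_add_left l_distr)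
    then show "P (vec_add R y z) = vec_add R (P y) (P z)"
      unfolding P_def vec_add_def vec_smult_def
      using vc[OF yz(1)] vc[OF yz(2)] xc cc[OF yz(1)] cc[OF yz(2)]
      by (simp add: fun_eq_iff l_distr minus_add a_ac)
  next
    fix d z assume dz: "d \<in> carrier R" "z \<in> vecs R ?n"
    have "c (vec_smult R d z) = d \<otimes> c z"
      using dz x t by (simp add: c_def Q.B_smult_left m_assoc)
    then show "P (vec_smult R d z) = vec_smult R d (P z)"
      unfolding P_def vec_add_def vec_smult_def
      using vc[OF dz(2)] xc cc[OF dz(2)] dz
      by (simp add: fun_eq_iff r_distr m_assoc r_minus l_minus)
  qed
  have linins: "linear_map R n' ?n ins"
  proof -
    have "ins y \<in> vecs R ?n" if "y \<in> vecs R n'" for y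
      using vc[OF that] vecs_outside[OF that] in' n by (auto simp: vecs_def ins_def)
    then show ?thesis
      by (auto simp: linear_map_def ins_def vec_add_def vec_smult_def fun_eq_iff)
  qed
  have del_closed: "del z \<in> vecs R n'" if "z \<in> vecs R ?n" for z
    using vc[OF that] vecs_outside[OF that] in' n by (auto simp: vecs_def del_def)
  have del_ins: "del (ins y) = y" for y
    by (auto simp: del_def ins_def fun_eq_iff)
  have ins_del: "ins (del z) = z" if "z i = \<zero>" for z
    using that by (auto simp: del_def ins_def fun_eq_iff)
  define N where "N = P \<circ> ins"
  have linN: "linear_map R n' ?n N"
    unfolding N_def by (rule linear_map_comp[OF linins linP])
  have BP: "qpolar R q (P z) x = \<zero>" if z: "z \<in> vecs R ?n" for z
  proof -
    have "qpolar R q (P z) x = qpolar R q z x \<oplus> \<ominus> c z \<otimes> ((\<one> \<oplus> \<one>) \<otimes> a)"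
      unfolding P_def using z x Bxx by (simp add: Q.B_add_left Q.B_smult_left)
    also have "c z \<otimes> ((\<one> \<oplus> \<one>) \<otimes> a) = qpolar R q z x \<otimes> (((\<one> \<oplus> \<one>) \<otimes> a) \<otimes> t)"
      unfolding c_def using z x t ac m_comm[of t "(\<one> \<oplus> \<one>) \<otimes> a"]
      by (simp add: m_assoc)
    then have "\<ominus> c z \<otimes> ((\<one> \<oplus> \<one>) \<otimes> a) = \<ominus> qpolar R q z x"
      using z x t ac by (simp add: l_minus)
    finally show ?thesis using z x by (simp add: r_neg)
  qed
  have Px: "P (vec_smult R d x) = vec_zero R" if d: "d \<in> carrier R" for d
  proof -
    have "c x = \<one>" using Bxx t by (simp add: c_def)
    then have "P x = vec_zero R"
      using xc by (simp add: P_def vec_add_def vec_smult_def vec_zero_def l_minus r_neg)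
    then show ?thesis using linear_map_smult[OF linP d x] d
      by (simp add: vec_smult_def vec_zero_def)
  qed
  obtain q' where q': "quadratic_form R q'" "qdim q' = n'"
      "\<And>y. y \<in> vecs R n' \<Longrightarrow> qeval R q' y = qeval R q (N y)"
    using quadratic_map.obtain_form[OF Q.quadratic_map_comp[OF linN]] by auto
  define f where "f = (\<lambda>w. vec_add R (vec_smult R (w 0) x) (N (vec_drop 1 w)))"
  have w0: "w 0 \<in> carrier R" "vec_drop (Suc 0) w \<in> vecs R n'" if "w \<in> vecs R (Suc n')" for w
    using vc[OF that] that vec_drop_closed[of w 1 n'] by auto
  have linf: "linear_map R (Suc n') ?n f"
    unfolding linear_map_def
  proof (intro conjI ballI)
    show "f \<in> vecs R (Suc n') \<rightarrow> vecs R ?n"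
      using x w0 linear_map_closed[OF linN] by (auto simp: f_def)
    fix y z assume yz: "y \<in> vecs R (Suc n')" "z \<in> vecs R (Suc n')"
    note yzN = linear_map_closed[OF linN w0(2)[OF yz(1)]] linear_map_closed[OF linN w0(2)[OF yz(2)]]
    show "f (vec_add R y z) = vec_add R (f y) (f z)"
      using yz w0 xc vc[OF yzN(1)] vc[OF yzN(2)] unfolding f_def
      by (simp add: vec_drop_add linear_map_add[OF linN])
         (simp add: vec_add_def vec_smult_def fun_eq_iff l_distr a_ac)
  next
    fix d z assume dz: "d \<in> carrier R" "z \<in> vecs R (Suc n')"
    note zN = linear_map_closed[OF linN w0(2)[OF dz(2)]]
    show "f (vec_smult R d z) = vec_smult R d (f z)"
      using dz w0 xc vc[OF zN] unfolding f_def
      by (simp add: vec_drop_smult linear_map_smult[OF linN])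
         (simp add: vec_add_def vec_smult_def fun_eq_iff r_distr m_assoc)
  qed
  \<comment> \<open>Inverting \<open>f\<close> requires recovering \<open>ins y\<close> from its
    projection. Subtracting the multiple of \<open>x\<close> that clears coordinate \<open>i\<close>
    does this, and it leaves \<open>P\<close> unchanged because \<open>P\<close> kills multiples of
    \<open>x\<close>.\<close>
  define r where "r = (\<lambda>z. vec_add R z (vec_smult R (\<ominus> (z i \<otimes> inv (x i))) x))"
  define g where "g = (\<lambda>z j. case j of 0 \<Rightarrow> c z | Suc j' \<Rightarrow> del (r z) j')"
  have r_closed [simp]: "r z \<in> vecs R ?n" if "z \<in> vecs R ?n" for z
    using that vc[OF that] x inv_nonzero[OF xc i] by (simp add: r_def)
  have ri: "r z i = \<zero>" if "z \<in> vecs R ?n" for z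
    using vc[OF that] xc inv_nonzero[OF xc i]
    by (simp add: r_def vec_add_def vec_smult_def l_minus m_assoc r_neg)
  have "linear_iso R (Suc n') ?n f"
  proof (rule linear_isoI[OF linf])
    show "g \<in> vecs R ?n \<rightarrow> vecs R (Suc n')"
    proof
      fix z assume z: "z \<in> vecs R ?n"
      show "g z \<in> vecs R (Suc n')"
        using vc[OF del_closed[OF r_closed[OF z]]] vecs_outside[OF del_closed[OF r_closed[OF z]]] z
        by (auto simp: vecs_def g_def split: nat.splits)
    qed
    show "f (g z) = z" if z: "z \<in> vecs R ?n" for z
    proof -
      have d: "vec_drop 1 (g z) = del (r z)" "g z 0 = c z"
        by (auto simp: vec_drop_def g_def fun_eq_iff)
      have m: "\<ominus> (z i \<otimes> inv (x i)) \<in> carrier R"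
        using vc[OF z] inv_nonzero[OF xc i] by simp
      have "P (r z) = P z"
        using linear_map_add[OF linP z vec_smult_closed[OF m x]] Px[OF m] z linear_map_closed[OF linP z]
        by (simp add: r_def)
      then have "f (g z) = vec_add R (vec_smult R (c z) x) (P z)"
        unfolding f_def d N_def using ins_del[of "r z", OF ri[OF z]] by simp
      also have "\<dots> = z"
        unfolding P_def using vc[OF z] xc cc[OF z]
        by (simp add: vec_add_def vec_smult_def fun_eq_iff l_minus a_lcomm[of _ "z _"] r_neg)
      finally show ?thesis .
    qed
    show "g (f w) = w" if w: "w \<in> vecs R (Suc n')" for w
    proof -
      let ?y = "vec_drop 1 w" let ?u = "ins (vec_drop 1 w)"
      have y: "?y \<in> vecs R n'" and w0c: "w 0 \<in> carrier R" using w0[OF w] by auto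
      have u: "?u \<in> vecs R ?n" by (rule linear_map_closed[OF linins y])
      have Nc: "N ?y \<in> vecs R ?n" by (rule linear_map_closed[OF linN y])
      have fw: "f w \<in> vecs R ?n" by (rule linear_map_closed[OF linf w])
      have "c (f w) = w 0"
      proof -
        have "qpolar R q (f w) x = w 0 \<otimes> ((\<one> \<oplus> \<one>) \<otimes> a) \<oplus> qpolar R q (N ?y) x"
          unfolding f_def using w0c x Nc Bxx by (simp add: Q.B_add_left Q.B_smult_left)
        also have "qpolar R q (N ?y) x = \<zero>"
          using BP[OF u] by (simp add: N_def)
        finally show ?thesis using w0c ac t by (simp add: c_def m_assoc)
      qed
      moreover have "r (f w) = ?u"
      proof -
        \<comment> \<open>\<open>f w\<close> differs from \<open>ins y\<close> by \<open>?m\<close>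
          times \<open>x\<close>. As \<open>ins y\<close> vanishes at \<open>i\<close>, coordinate
          \<open>i\<close> of \<open>f w\<close> is \<open>?m\<close> times \<open>x i\<close>, so
          \<open>r\<close> removes exactly this multiple.\<close>
        let ?m = "w 0 \<ominus> c ?u"
        have m: "?m \<in> carrier R" using w0c u by simp
        have fwe: "f w = vec_add R ?u (vec_smult R ?m x)"
          unfolding f_def N_def P_def o_def using vc[OF u] xc w0c cc[OF u]
          by (simp add: vec_add_def vec_smult_def fun_eq_iff minus_eq l_distr a_ac)
        have "?u i = \<zero>" by (simp add: ins_def)
        then have "f w i \<otimes> inv (x i) = ?m"
          using m xc inv_nonzero[OF xc i] by (simp add: fwe vec_add_def vec_smult_def m_assoc)
        then show ?thesis
          unfolding r_def using vec_add_minus_cancel[OF u x m] by (simp add: fwe)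
      qed
      then have "del (r (f w)) = ?y" by (simp only: del_ins)
      ultimately show ?thesis
        by (auto simp: g_def fun_eq_iff vec_drop_def split: nat.splits)
    qed
  qed
  then have "isometry R (orth_sum R (unary_form a) q') q f"
  proof (intro isometry_unary_I)
    fix w assume w': "w \<in> vecs R (Suc (qdim q'))"
    then have w: "w \<in> vecs R (Suc n')" by (simp add: q')
    let ?y = "vec_drop 1 w" let ?u = "ins (vec_drop 1 w)"
    have y: "?y \<in> vecs R n'" and w0c: "w 0 \<in> carrier R" using w0[OF w] by auto
    have u: "?u \<in> vecs R ?n" by (rule linear_map_closed[OF linins y])
    have Nc: "N ?y \<in> vecs R ?n" by (rule linear_map_closed[OF linN y])
    have "qpolar R q x (N ?y) = \<zero>"
      using BP[OF u] Q.B_commute[OF x Nc] by (simp add: N_def)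
    then have "qeval R q (f w) = w 0 \<otimes> w 0 \<otimes> a \<oplus> qeval R q (N ?y)"
      unfolding f_def using x w0c Nc a ac by (simp add: Q.Q_add Q.Q_smult Q.B_smult_left)
    then show "qeval R q (f w) = a \<otimes> w 0 \<otimes> w 0 \<oplus> qeval R q' (vec_drop 1 w)"
      using q'(3)[OF y] w0c ac by (simp add: m_ac)
  qed (use q q' ac in auto)
  moreover have "f (unit_vec R 0) = x"
  proof -
    have "vec_drop 1 (unit_vec R 0) = vec_zero R"
      by (auto simp: vec_drop_def unit_vec_def vec_zero_def)
    then show ?thesis
      using x xc linear_map_zero[OF linN] by (simp add: f_def unit_vec_def vec_smult_one[OF x])
  qed
  ultimately show ?thesis using that q' n by auto
qed

text \<open>
  Either the reflection along \<open>x - y\<close> or the negative of the reflection along \<open>x + y\<close> maps \<open>x\<close>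
  to \<open>y\<close>: the values of the form at these two vectors add up to \<open>4 a\<close>, so one of them is nonzero.
\<close>

lemma isometry_transitive:
  assumes q: "quadratic_form R q" and x: "x \<in> vecs R (qdim q)" and y: "y \<in> vecs R (qdim q)"
    and a: "qeval R q x = a" "qeval R q y = a" "a \<noteq> \<zero>"
  obtains f where "isometry R q q f" "f x = y"
proof -
  let ?n = "qdim q"
  interpret Q: quadratic_map R ?n "qeval R q" "qpolar R q"
    by (rule quadratic_map_qeval[OF q])
  note vc = vecs_carrier[OF is_cring]
  have ac: "a \<in> carrier R" using a(1) x by auto
  \<comment> \<open>One computation covers both reflections: \<open>e = \<ominus> \<one>\<close> is
    the one along x - y and \<open>e = \<one>\<close> the one along x + y.\<close>
  have refl: "\<exists>f. isometry R q q f \<and> f x = vec_smult R (\<ominus> e) y"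
    if e: "e \<in> carrier R" "e \<otimes> e = \<one>" and nz: "qeval R q (vec_add R x (vec_smult R e y)) \<noteq> \<zero>" for e
  proof -
    define w where "w = vec_add R x (vec_smult R e y)"
    have w: "w \<in> vecs R ?n" using x y e by (simp add: w_def)
    note wc = vc[OF w]
    define b where "b = qeval R q w"
    have b: "b \<in> carrier R" "b \<noteq> \<zero>" using w nz by (auto simp: b_def w_def)
    define t where "t = inv b"
    have t: "t \<in> carrier R" "b \<otimes> t = \<one>" using inv_nonzero[OF b] by (auto simp: t_def)
    define c where "c = (\<lambda>z. qpolar R q z w \<otimes> t)"
    have cc [simp]: "c z \<in> carrier R" if "z \<in> vecs R ?n" for z
      using that w t by (simp add: c_def)
    define f where "f = (\<lambda>z. vec_add R z (vec_smult R (\<ominus> c z) w))"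
    have Bww: "qpolar R q w w = (\<one> \<oplus> \<one>) \<otimes> b" using Q.B_self[OF w] by (simp add: b_def)
    have c_add: "c (vec_add R u z) = c u \<oplus> c z" if "u \<in> vecs R ?n" "z \<in> vecs R ?n" for u z
      using that w t by (simp add: c_def Q.B_add_left l_distr)
    have c_smult: "c (vec_smult R d z) = d \<otimes> c z" if "d \<in> carrier R" "z \<in> vecs R ?n" for d z
      using that w t by (simp add: c_def Q.B_smult_left m_assoc)
    have cw: "c w = \<one> \<oplus> \<one>"
      using t b by (simp add: c_def Bww m_assoc)
    have lin: "linear_map R ?n ?n f"
      unfolding linear_map_def
    proof (intro conjI ballI)
      show "f \<in> vecs R ?n \<rightarrow> vecs R ?n" using w by (auto simp: f_def)
      fix u z assume yz: "u \<in> vecs R ?n" "z \<in> vecs R ?n"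
      show "f (vec_add R u z) = vec_add R (f u) (f z)"
        unfolding f_def c_add[OF yz] unfolding vec_add_def vec_smult_def
        using vc[OF yz(1)] vc[OF yz(2)] wc cc[OF yz(1)] cc[OF yz(2)]
        by (simp add: fun_eq_iff l_distr minus_add a_ac)
    next
      fix d z assume dz: "d \<in> carrier R" "z \<in> vecs R ?n"
      show "f (vec_smult R d z) = vec_smult R d (f z)"
        unfolding f_def c_smult[OF dz] unfolding vec_add_def vec_smult_def
        using vc[OF dz(2)] wc cc[OF dz(2)] dz
        by (simp add: fun_eq_iff r_distr m_assoc r_minus l_minus)
    qed
    have ff: "f (f z) = z" if z: "z \<in> vecs R ?n" for z
    proof -
      have "c (f z) = c z \<oplus> \<ominus> c z \<otimes> (\<one> \<oplus> \<one>)"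
        unfolding f_def using z w cw by (simp add: c_add c_smult)
      also have "\<dots> = \<ominus> c z"
        using cc[OF z] by algebra
      finally show ?thesis
        using vec_add_minus_cancel[OF z w, of "\<ominus> c z"] cc[OF z] by (simp add: f_def)
    qed
    have "isometry R q q f"
      unfolding isometry_def
    proof (intro conjI ballI linear_isoI[OF lin, of f] ff)
      show "f \<in> vecs R ?n \<rightarrow> vecs R ?n" using w by (auto simp: f_def)
      fix z assume z: "z \<in> vecs R ?n"
      have "qeval R q (f z) = qeval R q z \<oplus> c z \<otimes> c z \<otimes> b \<oplus> \<ominus> c z \<otimes> qpolar R q z w"
        unfolding f_def using z w
        by (simp add: Q.Q_add Q.Q_smult Q.B_smult_right b_def l_minus r_minus)
      also have "qpolar R q z w = c z \<otimes> b"
        using z w b t by (simp add: c_def m_assoc m_comm[of t b])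
      also have "qeval R q z \<oplus> c z \<otimes> c z \<otimes> b \<oplus> \<ominus> c z \<otimes> (c z \<otimes> b) = qeval R q z"
        using z b by (simp add: l_minus m_assoc a_assoc r_neg)
      finally show "qeval R q (f z) = qeval R q z" .
    qed
    moreover have "f x = vec_smult R (\<ominus> e) y"
    proof -
      \<comment> \<open>As \<open>x\<close> and \<open>y\<close> have the same value and e^2 = 1,
        both Q w and B x w equal 2 a + e B x y. Hence \<open>c x\<close> is 1 and the reflection
        sends \<open>x\<close> to x - w = -e y.\<close>
      have "b = a \<oplus> a \<oplus> e \<otimes> qpolar R q x y"
        unfolding b_def w_def using x y e a ac by (simp add: Q.Q_add Q.Q_smult Q.B_smult_right)
      moreover have "qpolar R q x w = (\<one> \<oplus> \<one>) \<otimes> a \<oplus> e \<otimes> qpolar R q x y"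
        unfolding w_def using x y e a by (simp add: Q.B_add_right Q.B_smult_right Q.B_self)
      ultimately have "qpolar R q x w = b" using ac by (simp add: l_distr)
      then have "c x = \<one>" using t by (simp add: c_def)
      then show ?thesis
        using vc[OF x] vc[OF y] e
        by (simp add: f_def w_def vec_add_def vec_smult_def fun_eq_iff l_minus minus_add r_neg a_assoc[symmetric])
    qed
    ultimately show ?thesis by auto
  qed
  show ?thesis
  proof (cases "qeval R q (vec_add R x (vec_smult R (\<ominus> \<one>) y)) = \<zero>")
    case False
    obtain f where "isometry R q q f" "f x = vec_smult R (\<ominus> (\<ominus> \<one>)) y"
      using refl[OF _ _ False] by (auto simp: l_minus)
    then show ?thesis using that vec_smult_one[OF y] by simp
  next
    case True
    have "a \<oplus> a \<oplus> \<ominus> qpolar R q x y = \<zero>"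
      using True x y a ac by (simp add: Q.Q_add Q.Q_smult Q.B_smult_right l_minus)
    then have "qpolar R q x y = a \<oplus> a"
      using ac x y by (metis Q.B_closed a_closed minus_equality minus_minus a_inv_closed)
    then have "qeval R q (vec_add R x (vec_smult R \<one> y)) = (\<one> \<oplus> \<one>) \<otimes> ((\<one> \<oplus> \<one>) \<otimes> a)"
      using x y a ac by (simp add: Q.Q_add Q.Q_smult Q.B_smult_right l_distr a_assoc)
    then have "qeval R q (vec_add R x (vec_smult R \<one> y)) \<noteq> \<zero>"
      using double_nonzero[OF _ double_nonzero[OF ac a(3)]] ac by simp
    then obtain f where f: "isometry R q q f" "f x = vec_smult R (\<ominus> \<one>) y"
      using refl[of \<one>] by auto
    have neg: "isometry R q q (vec_smult R (\<ominus> \<one>))"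
      unfolding isometry_def
    proof (intro conjI ballI linear_isoI[of _ _ _ "vec_smult R (\<ominus> \<one>)"])
      show "linear_map R ?n ?n (vec_smult R (\<ominus> \<one>))"
        unfolding linear_map_def
      proof (intro conjI ballI)
        show "vec_smult R (\<ominus> \<one>) (vec_add R u z) = vec_add R (vec_smult R (\<ominus> \<one>) u) (vec_smult R (\<ominus> \<one>) z)"
          if "u \<in> vecs R ?n" "z \<in> vecs R ?n" for u z
          using vc[OF that(1)] vc[OF that(2)] by (simp add: vec_smult_def vec_add_def fun_eq_iff r_distr)
        show "vec_smult R (\<ominus> \<one>) (vec_smult R d z) = vec_smult R d (vec_smult R (\<ominus> \<one>) z)"
          if "d \<in> carrier R" "z \<in> vecs R ?n" for d z
          using that by (simp add: vec_smult_smult m_comm)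
      qed auto
      show "vec_smult R (\<ominus> \<one>) (vec_smult R (\<ominus> \<one>) z) = z" if "z \<in> vecs R ?n" for z
        using that by (simp add: vec_smult_smult vec_smult_one l_minus)
      then show "vec_smult R (\<ominus> \<one>) (vec_smult R (\<ominus> \<one>) z) = z" if "z \<in> vecs R ?n" for z
        using that .
      show "qeval R q (vec_smult R (\<ominus> \<one>) z) = qeval R q z" if "z \<in> vecs R ?n" for z
        using that by (simp add: Q.Q_smult l_minus)
    qed auto
    have "vec_smult R (\<ominus> \<one>) (f x) = y"
      using y by (simp add: f vec_smult_smult vec_smult_one l_minus)
    then show ?thesis
      using that[OF isometry_comp[OF f(1) neg]] by simp
  qed
qed

text \<open>Pairing with the first unit vector gives 2 a times the first coordinate. The complement
  of the summand <a> is thus given by the vanishing of that coordinate.\<close>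

lemma unary_orthogonal:
  assumes q: "quadratic_form R q" and a: "a \<in> carrier R" "a \<noteq> \<zero>"
    and w: "w \<in> vecs R (Suc (qdim q))"
    and 0: "qpolar R (orth_sum R (unary_form a) q) w (unit_vec R 0) = \<zero>"
  shows "w 0 = \<zero>"
proof -
  let ?U = "unary_form a"
  interpret U: quadratic_map R "qdim ?U" "qeval R ?U" "qpolar R ?U"
    by (rule quadratic_map_qeval[OF quadratic_form_unary[OF a(1)]])
  interpret Q: quadratic_map R "qdim q" "qeval R q" "qpolar R q"
    by (rule quadratic_map_qeval[OF q])
  have w0: "w 0 \<in> carrier R" by (rule vecs_carrier[OF is_cring w])
  have d: "vec_drop 1 (unit_vec R 0) = vec_zero R" "vec_drop 1 w \<in> vecs R (qdim q)"
    using w vec_drop_closed[of w 1] by (auto simp: vec_drop_def unit_vec_def vec_zero_def)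
  have e: "vec_trunc R 1 (unit_vec R 0) = unit_vec R 0" "vec_trunc R 1 w = vec_smult R (w 0) (unit_vec R 0)"
    using w0 by (auto simp: vec_trunc_def unit_vec_def vec_smult_def)
  have "qpolar R ?U (unit_vec R 0) (unit_vec R 0) = (\<one> \<oplus> \<one>) \<otimes> a"
    using U.B_self[of "unit_vec R 0"] a by (simp add: qeval_unary_unit_vec)
  then have "w 0 \<otimes> ((\<one> \<oplus> \<one>) \<otimes> a) = \<zero>"
    using 0 w w0 d e a q qpolar_orth_sum[of ?U q w "unit_vec R 0"] Q.B_commute[OF d(2) vec_zero_closed]
    by (simp add: Q.B_zero_left U.B_smult_left)
  from integral[OF this w0] show ?thesis using a double_nonzero[OF a] by auto
qed

text \<open>An isometry that fixes the first unit vector preserves orthogonality to it, hence maps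
  vectors with vanishing first coordinate to such vectors. This is what lets it restrict to the
  second summands.\<close>

lemma isometry_unary_tail:
  assumes q: "quadratic_form R q1" "quadratic_form R q2" and a: "a \<in> carrier R" "a \<noteq> \<zero>"
    and h: "isometry R (orth_sum R (unary_form a) q1) (orth_sum R (unary_form a) q2) h"
    and h0: "h (unit_vec R 0) = unit_vec R 0" and y: "y \<in> vecs R (qdim q1)"
  shows "h (vec_append 1 (vec_zero R) y)
    = vec_append 1 (vec_zero R) (vec_drop 1 (h (vec_append 1 (vec_zero R) y)))"
proof -
  let ?U = "unary_form a" let ?w = "vec_append 1 (vec_zero R) y"
  interpret U: quadratic_map R "qdim ?U" "qeval R ?U" "qpolar R ?U"
    by (rule quadratic_map_qeval[OF quadratic_form_unary[OF a(1)]])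
  interpret Q: quadratic_map R "qdim q1" "qeval R q1" "qpolar R q1"
    by (rule quadratic_map_qeval[OF q(1)])
  have w: "?w \<in> vecs R (Suc (qdim q1))"
    using vec_append_closed[OF vec_zero_closed y, of 1] by simp
  have d: "vec_drop 1 (unit_vec R 0) = vec_zero R" "vec_trunc R 1 ?w = vec_zero R"
    by (auto simp: vec_drop_def unit_vec_def vec_zero_def vec_trunc_def vec_append_def)
  have "vec_trunc R (Suc 0) (unit_vec R 0) \<in> vecs R (Suc 0)"
    by (auto simp: vecs_def vec_trunc_def unit_vec_def)
  then have "qpolar R (orth_sum R ?U q1) ?w (unit_vec R 0) = \<zero>"
    using w y d a q qpolar_orth_sum[of ?U q1 ?w "unit_vec R 0"] Q.B_commute[OF y vec_zero_closed]
      U.B_zero_left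
    by (simp add: Q.B_zero_left)
  then have "qpolar R (orth_sum R ?U q2) (h ?w) (unit_vec R 0) = \<zero>"
    using isometry_polar[OF h, of ?w "unit_vec R 0"] w h0 by simp
  moreover have "h ?w \<in> vecs R (Suc (qdim q2))"
    using linear_map_closed[OF isometryD(1)[OF h], of ?w] w by simp
  ultimately have "h ?w 0 = \<zero>"
    using unary_orthogonal[OF q(2) a] by blast
  then show ?thesis
    by (auto simp: vec_append_def vec_drop_def vec_zero_def)
qed

text \<open>The image of the first unit vector under the given isometry and the first unit vector of
  the target both have value \<open>a\<close>. An isometry of the target moves one to the other, and
  the corrected isometry restricts to the complements.\<close>

lemma unary_cancel:
  assumes q: "quadratic_form R q1" "quadratic_form R q2" and a: "a \<in> carrier R" "a \<noteq> \<zero>"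
    and iso: "isometric R (orth_sum R (unary_form a) q1) (orth_sum R (unary_form a) q2)"
  shows "isometric R q1 q2"
proof -
  let ?U = "unary_form a" let ?e = "unit_vec R 0"
  let ?V1 = "orth_sum R ?U q1" let ?V2 = "orth_sum R ?U q2"
  let ?n1 = "qdim q1" let ?n2 = "qdim q2"
  have V: "quadratic_form R ?V1" "quadratic_form R ?V2" using q a by auto
  obtain f where f: "isometry R ?V1 ?V2 f" using iso by (auto simp: isometric_iff)
  have qe: "qeval R (orth_sum R ?U q) ?e = a" if q: "quadratic_form R q" for q
  proof -
    interpret Q: quadratic_map R "qdim q" "qeval R q" "qpolar R q"
      by (rule quadratic_map_qeval[OF q])
    have d: "vec_drop 1 ?e = vec_zero R" "vec_trunc R 1 ?e = ?e"
      by (auto simp: vec_drop_def unit_vec_def vec_zero_def vec_trunc_def)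
    have "qeval R ?U ?e = a"
      using a by (simp add: qeval_unary_unit_vec)
    then show ?thesis using qeval_orth_sum[of ?U q ?e] q a d Q.Q_zero by simp
  qed
  have fe: "f ?e \<in> vecs R (qdim ?V2)"
    using linear_map_closed[OF isometryD(1)[OF f], of ?e] by simp
  have "qeval R ?V2 (f ?e) = a"
    using isometryD(3)[OF f, of ?e] qe[OF q(1)] by simp
  then obtain g where g: "isometry R ?V2 ?V2 g" "g (f ?e) = ?e"
    using isometry_transitive[OF V(2) fe _ _ qe[OF q(2)] a(2)] by auto
  define h where "h = g \<circ> f"
  have h: "isometry R ?V1 ?V2 h" unfolding h_def by (rule isometry_comp[OF f g(1)])
  have he: "h ?e = ?e" by (simp add: h_def g)
  define h' where "h' = inv_into (vecs R (qdim ?V1)) h"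
  have h': "isometry R ?V2 ?V1 h'" unfolding h'_def by (rule isometry_inverse[OF h])
  have h'h: "h' (h x) = x" if "x \<in> vecs R (qdim ?V1)" for x
    unfolding h'_def using bij_betw_inv_into_left[OF isometryD(2)[OF h] that] .
  have hh': "h (h' x) = x" if "x \<in> vecs R (qdim ?V2)" for x
    unfolding h'_def using bij_betw_inv_into_right[OF isometryD(2)[OF h] that] .
  \<comment> \<open>The inverse fixes the unit vector too, so it restricts in the same way, and its
    restriction inverts that of \<open>h\<close>.\<close>
  have h'e: "h' ?e = ?e" using h'h[of ?e] he by simp
  let ?i = "vec_append 1 (vec_zero R)"
  define k where "k = (\<lambda>y. vec_drop 1 (h (?i y)))"
  define k' where "k' = (\<lambda>y. vec_drop 1 (h' (?i y)))"
  have ik: "?i (k y) = h (?i y)" if "y \<in> vecs R ?n1" for y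
    using isometry_unary_tail[OF q a h he that] by (simp add: k_def)
  have ik': "?i (k' y) = h' (?i y)" if "y \<in> vecs R ?n2" for y
    using isometry_unary_tail[OF q(2,1) a h' h'e that] by (simp add: k'_def)
  have i_closed: "?i y \<in> vecs R (Suc n)" if "y \<in> vecs R n" for y n
    using vec_append_closed[OF vec_zero_closed that, of 1] by simp
  have drop_closed: "vec_drop (Suc 0) y \<in> vecs R n" if "y \<in> vecs R (Suc n)" for y n
    using vec_drop_closed[of y 1 n] that by simp
  have k_closed: "k y \<in> vecs R ?n2" if "y \<in> vecs R ?n1" for y
    using linear_map_closed[OF isometryD(1)[OF h], of "?i y"] i_closed[OF that] drop_closed
    by (simp add: k_def)
  have k'_closed: "k' y \<in> vecs R ?n1" if "y \<in> vecs R ?n2" for y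
    using linear_map_closed[OF isometryD(1)[OF h'], of "?i y"] i_closed[OF that] drop_closed
    by (simp add: k'_def)
  have zz: "vec_add R (vec_zero R) (vec_zero R) = vec_zero R"
    "\<And>c. c \<in> carrier R \<Longrightarrow> vec_smult R c (vec_zero R) = vec_zero R"
    by (auto simp: vec_add_def vec_zero_def vec_smult_def)
  have lin: "linear_map R ?n1 ?n2 k"
    unfolding linear_map_def
  proof (intro conjI ballI)
    fix x y assume xy: "x \<in> vecs R ?n1" "y \<in> vecs R ?n1"
    show "k (vec_add R x y) = vec_add R (k x) (k y)"
      using linear_map_add[OF isometryD(1)[OF h], of "?i x" "?i y"] xy i_closed
      by (simp add: k_def vec_append_add zz vec_drop_add)
  next
    fix c x assume cx: "c \<in> carrier R" "x \<in> vecs R ?n1"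
    show "k (vec_smult R c x) = vec_smult R c (k x)"
      using linear_map_smult[OF isometryD(1)[OF h], of c "?i x"] cx i_closed
      by (simp add: k_def vec_append_smult zz vec_drop_smult)
  qed (use k_closed in auto)
  have "isometry R q1 q2 k"
    unfolding isometry_def
  proof (intro conjI ballI linear_isoI[OF lin, of k'])
    show "k' \<in> vecs R ?n2 \<rightarrow> vecs R ?n1" using k'_closed by auto
    show "k' (k y) = y" if "y \<in> vecs R ?n1" for y
      using h'h[of "?i y"] i_closed[OF that] by (simp add: k'_def ik[OF that, unfolded One_nat_def])
    show "k (k' y) = y" if "y \<in> vecs R ?n2" for y
      using hh'[of "?i y"] i_closed[OF that] by (simp add: k_def ik'[OF that, unfolded One_nat_def])
    have qi: "qeval R (orth_sum R ?U q) (?i y) = qeval R q y"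
      if "quadratic_form R q" "y \<in> vecs R (qdim q)" for q y
    proof -
      interpret Q: quadratic_map R "qdim q" "qeval R q" "qpolar R q"
        by (rule quadratic_map_qeval[OF that(1)])
      interpret U: quadratic_map R "qdim ?U" "qeval R ?U" "qpolar R ?U"
        by (rule quadratic_map_qeval[OF quadratic_form_unary[OF a(1)]])
      have "vec_trunc R 1 (?i y) = vec_zero R"
        by (auto simp: vec_zero_def vec_trunc_def vec_append_def)
      then show ?thesis
        using qeval_orth_sum[of ?U q "?i y"] that a i_closed[OF that(2)] U.Q_zero by simp
    qed
    show "qeval R q2 (k y) = qeval R q1 y" if "y \<in> vecs R ?n1" for y
      using qi[OF q(2) k_closed[OF that]] qi[OF q(1) that] isometryD(3)[OF h, of "?i y"] i_closed[OF that]
      by (simp add: ik[OF that, unfolded One_nat_def])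
  qed
  then show ?thesis by (auto simp: isometric_iff)
qed

end

section \<open>The Witt index\<close>

text \<open>The predicate inside the description that defines \<open>witt_index\<close>, named so
  that existence and uniqueness can be treated apart.\<close>

definition witt_decomp :: "('a, 'b) ring_scheme \<Rightarrow> 'a qform \<Rightarrow> nat \<Rightarrow> bool" where
  "witt_decomp K q m \<longleftrightarrow> (\<exists>q_an. quadratic_form K q_an \<and> anisotropic K q_an \<and>
     isometric K q (orth_sum K (hyperbolic_form K m) q_an))"

lemma qdim_hyperbolic_plane [simp]: "qdim (hyperbolic_plane K) = 2"
  by (simp add: hyperbolic_plane_def)

lemma hyperbolic_form_Suc_orth_sum:
  "orth_sum K (hyperbolic_form K (Suc m)) q
    = orth_sum K (hyperbolic_plane K) (orth_sum K (hyperbolic_form K m) q)"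
  by (simp add: orth_sum_assoc)

lemma hyperbolic_form_add_orth_sum:
  "orth_sum K (hyperbolic_form K (m + d)) q
    = orth_sum K (hyperbolic_form K m) (orth_sum K (hyperbolic_form K d) q)"
proof (induction m)
  case 0
  show ?case by (simp only: add_0 orth_sum_hyperbolic_0)
next
  case (Suc m)
  then show ?case by (simp only: add_Suc hyperbolic_form_Suc_orth_sum)
qed

context field_char_not_2
begin

section \<open>Hyperbolic planes: diagonal form, cancellation and splitting\<close>

lemma qeval_hyperbolic_plane:
  assumes x: "x \<in> vecs R 2"
  shows "qeval R (hyperbolic_plane R) x = x 0 \<otimes> x 1"
proof -
  have "qeval R (hyperbolic_plane R) x = \<one> \<otimes> x 0 \<otimes> x 1"
    unfolding qeval_dsum using vecs_carrier[OF is_cring x]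
    by (subst dsum_single[where k = 0 and l = 1]) (auto simp: hyperbolic_plane_def)
  then show ?thesis using vecs_carrier[OF is_cring x] by simp
qed

lemma regular_unary:
  assumes a: "a \<in> carrier R" "a \<noteq> \<zero>"
  shows "regular_form R (unary_form a)"
  unfolding regular_form_def qdim_unary
proof (intro conjI ballI impI)
  let ?U = "unary_form a"
  interpret U: quadratic_map R "qdim ?U" "qeval R ?U" "qpolar R ?U"
    by (rule quadratic_map_qeval[OF quadratic_form_unary[OF a(1)]])
  show "quadratic_form R ?U" using a by simp
  fix x assume x: "x \<in> vecs R 1" and 0: "\<forall>y \<in> vecs R 1. qpolar R ?U x y = \<zero>"
  have x0: "x 0 \<in> carrier R" by (rule vecs_carrier[OF is_cring x])
  have xe: "x = vec_smult R (x 0) (unit_vec R 0)"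
    using x0 vecs_outside[OF x] by (auto simp: vec_smult_def unit_vec_def fun_eq_iff)
  have "qpolar R ?U (unit_vec R 0) (unit_vec R 0) = (\<one> \<oplus> \<one>) \<otimes> a"
    using U.B_self[of "unit_vec R 0"] a by (simp add: qeval_unary_unit_vec)
  then have "x 0 \<otimes> ((\<one> \<oplus> \<one>) \<otimes> a) = \<zero>"
    using 0 x0 U.B_smult_left[of "x 0" "unit_vec R 0" "unit_vec R 0"] xe by simp
  from integral[OF this x0] have "x 0 = \<zero>"
    using a double_nonzero[OF a] by auto
  then show "x = vec_zero R"
    using xe vec_smult_zero[of "unit_vec R 0" 1] by simp
qed

text \<open>The substitution (s, t) -> (s + t, s - t) turns the product of the coordinates into s^2
  - t^2.\<close>

lemma hyperbolic_plane_diagonal: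
  "isometric R (orth_sum R (unary_form \<one>) (unary_form (\<ominus> \<one>))) (hyperbolic_plane R)"
proof -
  let ?D = "orth_sum R (unary_form \<one>) (unary_form (\<ominus> \<one>))"
  note vc = vecs_carrier[OF is_cring]
  define h where "h = inv (\<one> \<oplus> \<one>)"
  have h: "h \<in> carrier R" "h \<oplus> h = \<one>"
    using inv_nonzero[OF _ two_nonzero] by (auto simp: h_def l_distr)
  define f :: "(nat \<Rightarrow> 'a) \<Rightarrow> nat \<Rightarrow> 'a"
    where "f = (\<lambda>w i. if i = 0 then w 0 \<oplus> w 1 else if i = 1 then w 0 \<ominus> w 1 else \<zero>)"
  \<comment> \<open>Applying the substitution twice multiplies by 2, so half of it is its
    inverse.\<close>
  define g where "g = (\<lambda>z. vec_smult R h (f z))"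
  have f_closed: "f w \<in> vecs R 2" if "w \<in> vecs R 2" for w
    using vc[OF that] by (auto simp: f_def vecs_def)
  have lin: "linear_map R 2 2 f"
    unfolding linear_map_def
  proof (intro conjI ballI)
    fix x y assume xy: "x \<in> vecs R 2" "y \<in> vecs R 2"
    show "f (vec_add R x y) = vec_add R (f x) (f y)"
      using vc[OF xy(1)] vc[OF xy(2)]
      by (auto simp: f_def vec_add_def fun_eq_iff minus_eq minus_add a_ac)
  next
    fix c x assume cx: "c \<in> carrier R" "x \<in> vecs R 2"
    show "f (vec_smult R c x) = vec_smult R c (f x)"
      using vc[OF cx(2)] cx by (auto simp: f_def vec_smult_def fun_eq_iff minus_eq r_distr r_minus)
  qed (use f_closed in auto)
  have half: "h \<otimes> ((a \<oplus> b) \<oplus> (a \<ominus> b)) = a" "h \<otimes> ((a \<oplus> b) \<ominus> (a \<ominus> b)) = b"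
    if "a \<in> carrier R" "b \<in> carrier R" for a b
  proof -
    have "h \<otimes> ((a \<oplus> b) \<oplus> (a \<ominus> b)) = (h \<oplus> h) \<otimes> a" "h \<otimes> ((a \<oplus> b) \<ominus> (a \<ominus> b)) = (h \<oplus> h) \<otimes> b"
      using that h(1) by algebra+
    then show "h \<otimes> ((a \<oplus> b) \<oplus> (a \<ominus> b)) = a" "h \<otimes> ((a \<oplus> b) \<ominus> (a \<ominus> b)) = b"
      using that h by simp_all
  qed
  have gf: "g (f w) = w" if w: "w \<in> vecs R 2" for w
    using vc[OF w] h vecs_outside[OF w] unfolding g_def f_def vec_smult_def
    by (auto simp: fun_eq_iff half)
  have "f (g z) = z" if z: "z \<in> vecs R 2" for z
    using gf[OF z] linear_map_smult[OF lin h(1) f_closed[OF z]] by (simp add: g_def)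
  then have iso: "linear_iso R 2 2 f"
    using lin gf f_closed h by (intro linear_isoI[of _ _ _ g]) (auto simp: g_def)
  have "qeval R (hyperbolic_plane R) (f w) = qeval R ?D w" if w: "w \<in> vecs R 2" for w
  proof -
    have d: "vec_drop 1 w \<in> vecs R 1"
      using w vec_drop_closed[of w 1 1] by (simp add: numeral_2_eq_2)
    have "qeval R ?D w = \<one> \<otimes> w 0 \<otimes> w 0 \<oplus> \<ominus> \<one> \<otimes> w 1 \<otimes> w 1"
      using qeval_orth_sum[of "unary_form \<one>" "unary_form (\<ominus> \<one>)" w] w d
        vec_trunc_closed[OF w, of 1 1]
      by (simp add: numeral_2_eq_2 qeval_unary[unfolded One_nat_def])
        (simp add: vec_trunc_def vec_drop_def)
    also have "\<dots> = (w 0 \<oplus> w 1) \<otimes> (w 0 \<ominus> w 1)"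
      using vc[OF w, of 0] vc[OF w, of 1] by algebra
    also have "\<dots> = qeval R (hyperbolic_plane R) (f w)"
      by (simp add: qeval_hyperbolic_plane[OF f_closed[OF w]]) (simp add: f_def)
    finally show ?thesis by simp
  qed
  then show ?thesis
    using iso unfolding isometric_def by (auto simp: numeral_2_eq_2)
qed

lemma minus_one_nonzero: "\<ominus> \<one> \<noteq> \<zero>"
  using minus_equality[of \<one> \<zero>] by (metis minus_minus minus_zero one_closed one_not_zero)

lemma regular_hyperbolic_plane: "regular_form R (hyperbolic_plane R)"
  using hyperbolic_plane_diagonal regular_unary[of \<one>] regular_unary[of "\<ominus> \<one>"] minus_one_nonzero
  by (intro regular_isometric[OF _ _ hyperbolic_plane_diagonal]) (auto simp: regular_orth_sum_iff)

lemma isometric_hyperbolic_plane_orth_sum: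
  assumes q: "quadratic_form R q"
  shows "isometric R (orth_sum R (hyperbolic_plane R) q)
    (orth_sum R (unary_form \<one>) (orth_sum R (unary_form (\<ominus> \<one>)) q))"
  unfolding orth_sum_assoc[symmetric]
  using q
    by (intro isometric_orth_sum isometric_sym[OF hyperbolic_plane_diagonal] isometric_refl) auto

lemma hyperbolic_plane_cancel:
  assumes q: "quadratic_form R q1" "quadratic_form R q2"
    and iso: "isometric R (orth_sum R (hyperbolic_plane R) q1) (orth_sum R (hyperbolic_plane R) q2)"
  shows "isometric R q1 q2"
proof -
  have "isometric R (orth_sum R (unary_form \<one>) (orth_sum R (unary_form (\<ominus> \<one>)) q1))
    (orth_sum R (unary_form \<one>) (orth_sum R (unary_form (\<ominus> \<one>)) q2))"
    by (rule isometric_trans[OF isometric_sym[OF isometric_hyperbolic_plane_orth_sum[OF q(1)]]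
          isometric_trans[OF iso isometric_hyperbolic_plane_orth_sum[OF q(2)]]])
  then have "isometric R (orth_sum R (unary_form (\<ominus> \<one>)) q1) (orth_sum R (unary_form (\<ominus> \<one>)) q2)"
    using q unary_cancel[OF _ _ one_closed one_not_zero] by simp
  then show ?thesis
    using q minus_one_nonzero unary_cancel[of q1 q2 "\<ominus> \<one>"] by simp
qed

lemma hyperbolic_form_cancel:
  assumes q: "quadratic_form R q1" "quadratic_form R q2"
    and iso: "isometric R (orth_sum R (hyperbolic_form R m) q1) (orth_sum R (hyperbolic_form R m) q2)"
  shows "isometric R q1 q2"
  using iso
proof (induction m)
  case 0
  then show ?case by (simp only: orth_sum_hyperbolic_0)
next
  case (Suc m)
  then show ?case
    using q Suc.IH hyperbolic_plane_cancel[OF _ _ Suc.prems[unfolded hyperbolic_form_Suc_orth_sum]]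
    by simp
qed

text \<open>Reduces the plane to two unary splittings. Regularity lets the isotropic vector be
  completed to a hyperbolic pair, whose sum and difference are orthogonal with values 1 and -1;
  splitting off <1> and <-1> in turn and recombining them gives the plane.\<close>

lemma split_hyperbolic_plane:
  assumes r: "regular_form R q" and x: "x \<in> vecs R (qdim q)" "x \<noteq> vec_zero R" "qeval R q x = \<zero>"
  obtains q' where "quadratic_form R q'" "qdim q = Suc (Suc (qdim q'))"
    "isometric R q (orth_sum R (hyperbolic_plane R) q')"
proof -
  let ?n = "qdim q"
  note q = regular_formD[OF r]
  interpret Q: quadratic_map R ?n "qeval R q" "qpolar R q"
    by (rule quadratic_map_qeval[OF q])
  obtain z where z: "z \<in> vecs R ?n" "qpolar R q x z \<noteq> \<zero>"
    using r x by (auto simp: regular_form_def)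
  have Bc: "qpolar R q x z \<in> carrier R" using x z by simp
  note i = inv_nonzero[OF Bc z(2)]
  define y where "y = vec_smult R (inv (qpolar R q x z)) z"
  have y: "y \<in> vecs R ?n" "qpolar R q x y = \<one>"
    using i x z by (simp_all add: y_def Q.B_smult_right)
  have Bxx: "qpolar R q x x = \<zero>" using Q.B_self[OF x(1)] x by simp
  have yx: "qpolar R q y x = \<one>" using Q.B_commute[OF y(1) x(1)] y by simp
  \<comment> \<open>Adding a multiple of the isotropic \<open>x\<close> keeps the pairing with
    \<open>x\<close> at 1 and changes the value by the factor itself, so the factor -Q y makes
    \<open>f\<close> isotropic.\<close>
  define f where "f = vec_add R y (vec_smult R (\<ominus> qeval R q y) x)"
  have f: "f \<in> vecs R ?n" using x y by (simp add: f_def)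
  have Qf: "qeval R q f = \<zero>" and Bxf: "qpolar R q x f = \<one>"
    using x y yx Bxx by (simp_all add: f_def Q.Q_add Q.Q_smult Q.B_smult_right Q.B_add_right r_neg)
  have Bfx: "qpolar R q f x = \<one>" and Bff: "qpolar R q f f = \<zero>"
    using Q.B_commute[OF f x(1)] Bxf Q.B_self[OF f] Qf by simp_all
  \<comment> \<open>Since \<open>x\<close> and \<open>f\<close> are isotropic, only the cross term
    remains: x + f has value 1 and x - f has value -1. They are orthogonal because the two cross
    terms cancel.\<close>
  define u where "u = vec_add R x f"
  define w where "w = vec_add R x (vec_smult R (\<ominus> \<one>) f)"
  have uw: "u \<in> vecs R ?n" "w \<in> vecs R ?n" using x f by (simp_all add: u_def w_def)
  have Qu: "qeval R q u = \<one>"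
    using x f Qf Bxf by (simp add: u_def Q.Q_add)
  have Qw: "qeval R q w = \<ominus> \<one>"
    using x f Qf Bxf by (simp add: w_def Q.Q_add Q.Q_smult Q.B_smult_right)
  have Bwu: "qpolar R q w u = \<zero>"
    using x f Bxx Bxf Bfx Bff
    by (simp add: w_def u_def Q.B_add_left Q.B_add_right Q.B_smult_left l_neg)
  obtain q1 F where q1: "quadratic_form R q1" "?n = Suc (qdim q1)"
    and F: "isometry R (orth_sum R (unary_form \<one>) q1) q F" "F (unit_vec R 0) = u"
    using split_unary[OF q uw(1) Qu one_not_zero] by auto
  let ?V = "orth_sum R (unary_form \<one>) q1"
  \<comment> \<open>\<open>w'\<close> is \<open>w\<close> in the coordinates of the first splitting.
    Being orthogonal to the first unit vector, it lies in the summand \<open>q1\<close>, where <-1>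
    can then be split off.\<close>
  obtain w' where w': "w' \<in> vecs R (qdim ?V)" "F w' = w"
    using isometryD(2)[OF F(1)] uw(2) by (metis bij_betw_imp_surj_on imageE)
  then have w'': "w' \<in> vecs R (Suc (qdim q1))" by simp
  have "qpolar R ?V w' (unit_vec R 0) = \<zero>"
    using isometry_polar[OF F(1) w'(1), of "unit_vec R 0"] F(2) w'(2) Bwu by simp
  then have w0: "w' 0 = \<zero>" using unary_orthogonal[OF q1(1) one_closed one_not_zero w''] by simp
  have d: "vec_drop 1 w' \<in> vecs R (qdim q1)" using w'' vec_drop_closed[of w' 1] by simp
  interpret Q1: quadratic_map R "qdim q1" "qeval R q1" "qpolar R q1"
    by (rule quadratic_map_qeval[OF q1(1)])
  have "vec_trunc R 1 w' = vec_zero R" using w0 by (auto simp: vec_trunc_def vec_zero_def)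
  then have "qeval R q1 (vec_drop 1 w') = \<ominus> \<one>"
    using isometryD(3)[OF F(1) w'(1)] Qw w' q1 d qeval_orth_sum[of "unary_form \<one>" q1 w']
      qeval_unary[OF one_closed vec_zero_closed]
    by (simp add: vec_zero_def)
  then obtain q2 G where q2: "quadratic_form R q2" "qdim q1 = Suc (qdim q2)"
    and G: "isometry R (orth_sum R (unary_form (\<ominus> \<one>)) q2) q1 G"
    using split_unary[OF q1(1) d _ minus_one_nonzero] by metis
  have G': "isometric R q1 (orth_sum R (unary_form (\<ominus> \<one>)) q2)"
    using G isometric_iff isometric_sym by blast
  have "isometric R q (orth_sum R (unary_form \<one>) q1)"
    using F(1) isometric_iff isometric_sym by blast
  also have "isometric R (orth_sum R (unary_form \<one>) q1)
      (orth_sum R (unary_form \<one>) (orth_sum R (unary_form (\<ominus> \<one>)) q2))"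
    using G' q1 q2 by (intro isometric_orth_sum isometric_refl) auto
  also have "isometric R (orth_sum R (unary_form \<one>) (orth_sum R (unary_form (\<ominus> \<one>)) q2))
      (orth_sum R (hyperbolic_plane R) q2)"
    by (rule isometric_sym[OF isometric_hyperbolic_plane_orth_sum[OF q2(1)]])
  finally show ?thesis using that q2 q1 by auto
qed

section \<open>Existence and uniqueness of the Witt decomposition, and the resulting rules for the
  index\<close>

lemma isotropic_hyperbolic:
  assumes q: "quadratic_form R q" and iso: "isometric R q' (orth_sum R (hyperbolic_plane R) q)"
  shows "\<not> anisotropic R q'"
proof
  assume an: "anisotropic R q'"
  let ?e = "unit_vec R 0" let ?V = "orth_sum R (hyperbolic_plane R) q"
  interpret Q: quadratic_map R "qdim q" "qeval R q" "qpolar R q"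
    by (rule quadratic_map_qeval[OF q])
  obtain f where f: "isometry R ?V q' f"
    using isometric_sym[OF iso] by (auto simp: isometric_iff)
  have e: "?e \<in> vecs R (qdim ?V)" by simp
  have "vec_trunc R 2 ?e = ?e" "vec_drop 2 ?e = vec_zero R"
    by (auto simp: vec_trunc_def vec_drop_def unit_vec_def vec_zero_def)
  moreover have "qeval R (hyperbolic_plane R) ?e = \<zero>"
    using qeval_hyperbolic_plane[of ?e] unit_vec_closed[of 0 2] by (simp add: unit_vec_def)
  ultimately have "qeval R ?V ?e = \<zero>"
    using qeval_orth_sum[of "hyperbolic_plane R" q ?e] q Q.Q_zero by simp
  then have "f ?e = vec_zero R"
    using an isometryD(3)[OF f e] linear_map_closed[OF isometryD(1)[OF f] e]
    by (simp add: anisotropic_def)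
  also have "\<dots> = f (vec_zero R)" by (simp add: linear_map_zero[OF isometryD(1)[OF f]])
  finally have "?e = vec_zero R"
    using isometryD(2)[OF f] e by (auto simp: bij_betw_def dest: inj_onD)
  from fun_cong[OF this, of 0] show False by (simp add: unit_vec_def vec_zero_def)
qed

text \<open>Cancelling the common \<open>m\<close> planes would make the anisotropic part of the
  first decomposition isometric to a form that still contains a hyperbolic plane.\<close>

lemma witt_decomp_not_less:
  assumes "witt_decomp R q m" "witt_decomp R q m'"
  shows "\<not> m < m'"
proof
  assume "m < m'"
  then obtain d where d: "m' = m + Suc d" using less_iff_Suc_add by auto
  obtain a b where a: "quadratic_form R a" "anisotropic R a"
      "isometric R q (orth_sum R (hyperbolic_form R m) a)"
    and b: "quadratic_form R b" "isometric R q (orth_sum R (hyperbolic_form R m') b)"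
    using assms by (auto simp: witt_decomp_def)
  have "isometric R (orth_sum R (hyperbolic_form R m) a)
      (orth_sum R (hyperbolic_form R m) (orth_sum R (hyperbolic_form R (Suc d)) b))"
    using isometric_trans[OF isometric_sym[OF a(3)] b(2)]
    unfolding d hyperbolic_form_add_orth_sum .
  then have "isometric R a (orth_sum R (hyperbolic_form R (Suc d)) b)"
    using hyperbolic_form_cancel[where m = m, OF a(1)] b(1)
    by (simp only: quadratic_form_orth_sum quadratic_form_hyperbolic_form)
  then show False
    using isotropic_hyperbolic[of "orth_sum R (hyperbolic_form R d) b" a] a b
    unfolding hyperbolic_form_Suc_orth_sum by simp
qed

lemma witt_decomp_unique: "witt_decomp R q m \<Longrightarrow> witt_decomp R q m' \<Longrightarrow> m = m'"
  by (rule linorder_cases[of m m']) (auto dest: witt_decomp_not_less)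

lemma witt_decomp_isometric: "witt_decomp R q m \<Longrightarrow> isometric R q' q \<Longrightarrow> witt_decomp R q' m"
  unfolding witt_decomp_def by (blast intro: isometric_trans)

lemma witt_decomp_hyperbolic_plane:
  assumes q: "quadratic_form R q" and m: "witt_decomp R q m"
  shows "witt_decomp R (orth_sum R (hyperbolic_plane R) q) (Suc m)"
proof -
  obtain a where a: "quadratic_form R a" "anisotropic R a"
      "isometric R q (orth_sum R (hyperbolic_form R m) a)"
    using m by (auto simp: witt_decomp_def)
  have "isometric R (orth_sum R (hyperbolic_plane R) q) (orth_sum R (hyperbolic_form R (Suc m)) a)"
    unfolding hyperbolic_form_Suc_orth_sum using q a
      by (intro isometric_orth_sum isometric_refl) auto
  then show ?thesis using a by (auto simp only: witt_decomp_def)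
qed

text \<open>An isotropic vector splits off a plane and lowers the dimension by two. The complement
  is regular again, so the descent goes on until an anisotropic form is left, possibly of dimension
  zero.\<close>

lemma witt_decomp_exists: "regular_form R q \<Longrightarrow> \<exists>m. witt_decomp R q m"
proof (induction "qdim q" arbitrary: q rule: less_induct)
  case less
  note q = regular_formD[OF less.prems]
  show ?case
  proof (cases "anisotropic R q")
    case True
    have "witt_decomp R q 0"
      unfolding witt_decomp_def orth_sum_hyperbolic_0 using q True isometric_refl by blast
    then show ?thesis ..
  next
    case False
    then obtain x where "x \<in> vecs R (qdim q)" "x \<noteq> vec_zero R" "qeval R q x = \<zero>"
      by (auto simp: anisotropic_def)
    then obtain q' where q': "quadratic_form R q'" "qdim q = Suc (Suc (qdim q'))"
      "isometric R q (orth_sum R (hyperbolic_plane R) q')"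
      using split_hyperbolic_plane[OF less.prems] by metis
    have "regular_form R q'"
      using regular_isometric[OF less.prems _ q'(3)] q'(1) by (simp add: regular_orth_sum_iff)
    then obtain m where "witt_decomp R q' m"
      using less.hyps[of q'] q' by auto
    then show ?thesis
      using witt_decomp_isometric[OF witt_decomp_hyperbolic_plane[OF q'(1)] q'(3)] by blast
  qed
qed

lemma witt_index_eq: "witt_decomp R q m \<Longrightarrow> witt_index R q = m"
  unfolding witt_index_def witt_decomp_def[symmetric]
  by (rule the_equality) (auto dest: witt_decomp_unique)

lemma witt_index_decomp: "regular_form R q \<Longrightarrow> witt_decomp R q (witt_index R q)"
  using witt_decomp_exists[of q] witt_index_eq[of q] by auto

lemma witt_index_isometric:
  "regular_form R q \<Longrightarrow> isometric R q' q \<Longrightarrow> witt_index R q' = witt_index R q"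
  by (rule witt_index_eq[OF witt_decomp_isometric[OF witt_index_decomp]])

lemma witt_index_hyperbolic_plane:
  "regular_form R q \<Longrightarrow> witt_index R (orth_sum R (hyperbolic_plane R) q) = Suc (witt_index R q)"
  by (rule witt_index_eq[OF witt_decomp_hyperbolic_plane[OF regular_formD witt_index_decomp]])

lemma regular_hyperbolic_form_orth_sum:
  "regular_form R q \<Longrightarrow> regular_form R (orth_sum R (hyperbolic_form R m) q)"
proof (induction m)
  case 0
  then show ?case by (simp only: orth_sum_hyperbolic_0)
next
  case (Suc m)
  then have "quadratic_form R (orth_sum R (hyperbolic_form R m) q)" by (simp add: regular_formD)
  with Suc show ?case
    unfolding hyperbolic_form_Suc_orth_sum
    by (subst regular_orth_sum_iff) (auto intro: regular_hyperbolic_plane)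
qed

lemma witt_index_hyperbolic_form:
  "regular_form R q \<Longrightarrow> witt_index R (orth_sum R (hyperbolic_form R m) q) = m + witt_index R q"
proof (induction m)
  case 0
  then show ?case by (simp only: orth_sum_hyperbolic_0)
next
  case (Suc m)
  then show ?case
    unfolding hyperbolic_form_Suc_orth_sum
    using witt_index_hyperbolic_plane[OF regular_hyperbolic_form_orth_sum[OF Suc.prems, of m]] by simp
qed

text \<open>Provides the plane that the upward step removes. The complement keeps the other planes
  and is regular, so the principle can be applied to it.\<close>

lemma witt_index_pos_split:
  assumes r: "regular_form R q" and pos: "witt_index R q > 0"
  obtains q' where "regular_form R q'" "isometric R q (orth_sum R (hyperbolic_plane R) q')"
proof -
  obtain m where "witt_index R q = Suc m" using pos by (cases "witt_index R q") auto
  then obtain a where a: "quadratic_form R a" "isometric R q (orth_sum R (hyperbolic_form R (Suc m)) a)"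
    using witt_index_decomp[OF r] by (auto simp: witt_decomp_def)
  let ?q' = "orth_sum R (hyperbolic_form R m) a"
  have q': "quadratic_form R ?q'" using a by simp
  have iso: "isometric R q (orth_sum R (hyperbolic_plane R) ?q')"
    using a(2) unfolding hyperbolic_form_Suc_orth_sum .
  have "regular_form R ?q'"
    using regular_isometric[OF r _ iso] q' by (simp add: regular_orth_sum_iff)
  then show ?thesis using that iso by blast
qed

end

section \<open>Base change along a field homomorphism\<close>

lemma qdim_map_qform [simp]: "qdim (map_qform f q) = qdim q"
  by (cases q) simp

lemma qcoeff_map_qform [simp]: "qcoeff (map_qform f q) i j = f (qcoeff q i j)"
  by (cases q) simp

lemma qform_eqI: "qdim p = qdim q \<Longrightarrow> (\<And>i j. qcoeff p i j = qcoeff q i j) \<Longrightarrow> p = q"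
  by (cases p; cases q) (simp add: fun_eq_iff)

text \<open>The product of the vector \<open>x\<close> with the matrix whose columns are
  \<open>w 0\<close>, ..., \<open>w (m - 1)\<close>.\<close>

primrec lin_comb :: "('a, 'b) ring_scheme \<Rightarrow> (nat \<Rightarrow> nat \<Rightarrow> 'a) \<Rightarrow> nat \<Rightarrow> (nat \<Rightarrow> 'a) \<Rightarrow> nat \<Rightarrow> 'a" where
  "lin_comb K w 0 x = vec_zero K"
| "lin_comb K w (Suc m) x = vec_add K (lin_comb K w m x) (vec_smult K (x m) (w m))"

lemma (in cring) linear_map_lin_comb:
  assumes w: "\<And>i. i < m \<Longrightarrow> w i \<in> vecs R n"
  shows "linear_map R m n (lin_comb R w m)"
proof -
  note vc = vecs_carrier[OF is_cring]
  have cl: "k \<le> m \<Longrightarrow> lin_comb R w k x \<in> vecs R n" if "x \<in> vecs R m" for k x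
    using vc[OF that] w by (induction k) auto
  have add: "k \<le> m \<Longrightarrow>
      lin_comb R w k (vec_add R x y) = vec_add R (lin_comb R w k x) (lin_comb R w k y)"
    if xy: "x \<in> vecs R m" "y \<in> vecs R m" for k x y
  proof (induction k)
    case (Suc k)
    have "w k \<in> vecs R n" using w Suc.prems by simp
    from vc[OF this] show ?case
      using Suc vc[OF xy(1)] vc[OF xy(2)] vc[OF cl[OF xy(1)], of k] vc[OF cl[OF xy(2)], of k]
      by (simp add: vec_add_def vec_smult_def fun_eq_iff l_distr a_ac)
  qed (simp add: vec_add_def vec_zero_def)
  have smult: "k \<le> m \<Longrightarrow> lin_comb R w k (vec_smult R c x) = vec_smult R c (lin_comb R w k x)"
    if cx: "c \<in> carrier R" "x \<in> vecs R m" for k c x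
  proof (induction k)
    case (Suc k)
    have "w k \<in> vecs R n" using w Suc.prems by simp
    from vc[OF this] show ?case
      using Suc vc[OF cx(2)] vc[OF cl[OF cx(2)], of k] cx(1)
      by (simp add: vec_add_def vec_smult_def fun_eq_iff r_distr m_assoc)
  qed (use cx in \<open>simp add: vec_smult_def vec_zero_def\<close>)
  show ?thesis
    unfolding linear_map_def
      using cl[OF _ le_refl] add[OF _ _ le_refl] smult[OF _ _ le_refl] by auto
qed

text \<open>Applied to the embedding of the base field into a completion. A homomorphism of fields
  is injective, so 2 stays nonzero in \<open>L\<close> and the theory of the Witt index is available
  there too.\<close>

locale field_hom = K: field_char_not_2 K + L: field L
  for K :: "('a, 'c) ring_scheme" and L :: "('b, 'd) ring_scheme" +
  fixes \<phi> :: "'a \<Rightarrow> 'b"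
  assumes hom: "\<phi> \<in> ring_hom K L"
begin

sublocale H: ring_hom_cring K L \<phi>
  by unfold_locales (rule hom)

lemma hom_nonzero: "a \<in> carrier K \<Longrightarrow> a \<noteq> \<zero>\<^bsub>K\<^esub> \<Longrightarrow> \<phi> a \<noteq> \<zero>\<^bsub>L\<^esub>"
  using K.inv_nonzero[of a] H.hom_mult[of a "inv\<^bsub>K\<^esub> a"] L.one_not_zero by auto

sublocale L: field_char_not_2 L
  using hom_nonzero[OF _ K.two_nonzero] by unfold_locales simp

lemma hom_a_minus: "x \<in> carrier K \<Longrightarrow> y \<in> carrier K \<Longrightarrow> \<phi> (x \<ominus>\<^bsub>K\<^esub> y) = \<phi> x \<ominus>\<^bsub>L\<^esub> \<phi> y"
  by (simp add: K.minus_eq L.minus_eq)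

lemma vecs_hom: "x \<in> vecs K n \<Longrightarrow> \<phi> \<circ> x \<in> vecs L n"
  by (auto simp: vecs_def)

lemma hom_vec_add:
  assumes "x \<in> vecs K n" "y \<in> vecs K n"
  shows "\<phi> \<circ> vec_add K x y = vec_add L (\<phi> \<circ> x) (\<phi> \<circ> y)"
  using vecs_carrier[OF K.is_cring assms(1)] vecs_carrier[OF K.is_cring assms(2)]
  by (simp add: vec_add_def fun_eq_iff)

lemma hom_vec_smult:
  assumes "c \<in> carrier K" "x \<in> vecs K n"
  shows "\<phi> \<circ> vec_smult K c x = vec_smult L (\<phi> c) (\<phi> \<circ> x)"
  using assms(1) vecs_carrier[OF K.is_cring assms(2)] by (simp add: vec_smult_def fun_eq_iff)

lemma hom_unit_vec: "\<phi> \<circ> unit_vec K i = unit_vec L i"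
  by (simp add: unit_vec_def fun_eq_iff)

lemma quadratic_form_map: "quadratic_form K q \<Longrightarrow> quadratic_form L (map_qform \<phi> q)"
  by (simp add: quadratic_form_def)

text \<open>An equality of forms, like the next three rules, so the base change of a sum with
  hyperbolic planes is found by rewriting, without an isometry.\<close>

lemma map_orth_sum:
  "map_qform \<phi> (orth_sum K p q) = orth_sum L (map_qform \<phi> p) (map_qform \<phi> q)"
  by (rule qform_eqI) (auto simp: orth_sum_def)

lemma map_hyperbolic_plane: "map_qform \<phi> (hyperbolic_plane K) = hyperbolic_plane L"
  by (rule qform_eqI) (auto simp: hyperbolic_plane_def)

lemma map_hyperbolic_form: "map_qform \<phi> (hyperbolic_form K m) = hyperbolic_form L m"
  by (induction m) (simp_all add: map_orth_sum map_hyperbolic_plane fun_eq_iff)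

lemma map_unary_form: "map_qform \<phi> (unary_form a) = unary_form (\<phi> a)"
  by (rule qform_eqI) (auto simp: unary_form_def)

section \<open>Values, isometries and regularity under extension of scalars\<close>

lemma qeval_map:
  assumes q: "quadratic_form K q" and x: "x \<in> vecs K (qdim q)"
  shows "qeval L (map_qform \<phi> q) (\<phi> \<circ> x) = \<phi> (qeval K q x)"
proof -
  have qc: "qcoeff q i j \<in> carrier K" if "i \<le> j" "j < qdim q" for i j
    using q that by (auto simp: quadratic_form_def)
  note xc = vecs_carrier[OF K.is_cring x]
  have "\<phi> (qeval K q x) = (\<Oplus>\<^bsub>L\<^esub>j \<in> {..<qdim q}. \<phi> (\<Oplus>\<^bsub>K\<^esub>i \<in> {..j}. qcoeff q i j \<otimes>\<^bsub>K\<^esub> x i \<otimes>\<^bsub>K\<^esub> x j))"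
    unfolding qeval_def using qc xc
    by (subst H.hom_finsum) (auto intro!: K.finsum_closed simp: o_def)
  also have "\<dots> = qeval L (map_qform \<phi> q) (\<phi> \<circ> x)"
    unfolding qeval_def
  proof (rule L.finsum_cong')
    fix j assume "j \<in> {..<qdim (map_qform \<phi> q)}"
    then have j: "j < qdim q" by simp
    have "\<phi> (\<Oplus>\<^bsub>K\<^esub>i \<in> {..j}. qcoeff q i j \<otimes>\<^bsub>K\<^esub> x i \<otimes>\<^bsub>K\<^esub> x j)
        = (\<Oplus>\<^bsub>L\<^esub>i \<in> {..j}. \<phi> (qcoeff q i j \<otimes>\<^bsub>K\<^esub> x i \<otimes>\<^bsub>K\<^esub> x j))"
      using qc xc j by (subst H.hom_finsum) (auto simp: o_def)
    also have "\<dots> = (\<Oplus>\<^bsub>L\<^esub>i \<in> {..j}. qcoeff (map_qform \<phi> q) i j \<otimes>\<^bsub>L\<^esub> (\<phi> \<circ> x) i \<otimes>\<^bsub>L\<^esub> (\<phi> \<circ> x) j)"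
      using qc xc j by (intro L.finsum_cong') auto
    finally show "\<phi> (\<Oplus>\<^bsub>K\<^esub>i \<in> {..j}. qcoeff q i j \<otimes>\<^bsub>K\<^esub> x i \<otimes>\<^bsub>K\<^esub> x j)
        = (\<Oplus>\<^bsub>L\<^esub>i \<in> {..j}. qcoeff (map_qform \<phi> q) i j \<otimes>\<^bsub>L\<^esub> (\<phi> \<circ> x) i \<otimes>\<^bsub>L\<^esub> (\<phi> \<circ> x) j)" .
  qed (use qc xc in \<open>auto intro!: L.finsum_closed\<close>)
  finally show ?thesis by simp
qed

lemma qpolar_map:
  assumes q: "quadratic_form K q" and x: "x \<in> vecs K (qdim q)" and y: "y \<in> vecs K (qdim q)"
  shows "qpolar L (map_qform \<phi> q) (\<phi> \<circ> x) (\<phi> \<circ> y) = \<phi> (qpolar K q x y)"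
proof -
  interpret Q: quadratic_map K "qdim q" "qeval K q" "qpolar K q"
    by (rule K.quadratic_map_qeval[OF q])
  show ?thesis
    unfolding qpolar_def hom_vec_add[OF x y, symmetric]
    using x y by (simp add: qeval_map[OF q] hom_a_minus)
qed

text \<open>The matrix of \<open>f\<close> has the columns \<open>f (unit_vec K i)\<close>; applying
  \<open>\<phi>\<close> to its entries gives the matrix of \<open>F\<close>.\<close>

lemma linear_map_extend:
  assumes f: "linear_map K m n f"
  obtains F where "linear_map L m n F" "\<And>x. x \<in> vecs K m \<Longrightarrow> F (\<phi> \<circ> x) = \<phi> \<circ> f x"
proof -
  let ?w = "\<lambda>i. \<phi> \<circ> f (unit_vec K i)"
  have w: "?w i \<in> vecs L n" if "i < m" for i
    using that by (intro vecs_hom K.linear_map_closed[OF f]) simp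
  have "k \<le> m \<Longrightarrow> lin_comb L ?w k (\<phi> \<circ> x) = \<phi> \<circ> f (vec_trunc K k x)" if x: "x \<in> vecs K m" for k x
  proof (induction k)
    case 0
    then show ?case
      by (simp add: K.vec_trunc_0 K.linear_map_zero[OF f]) (simp add: vec_zero_def fun_eq_iff)
  next
    case (Suc k)
    have k: "unit_vec K k \<in> vecs K m" "x k \<in> carrier K" "vec_trunc K k x \<in> vecs K m"
      using Suc.prems x vecs_carrier[OF K.is_cring x] by auto
    note fk = K.linear_map_closed[OF f k(1)]
    show ?case
      using Suc k fk K.linear_map_closed[OF f k(3)]
      by (simp add: K.vec_trunc_Suc[OF x] K.linear_map_add[OF f] K.linear_map_smult[OF f]
          hom_vec_add[of _ n] hom_vec_smult[of _ _ n]) (simp add: o_def)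
  qed
  from this[OF _ le_refl] show ?thesis
    using that[OF L.linear_map_lin_comb[of m ?w n, OF w]] by (simp add: K.vec_trunc_id)
qed

text \<open>Extend the isometry and its inverse separately. That the extensions are inverse to each
  other and that \<open>F\<close> preserves values can be tested on unit vectors, which come from
  \<open>K\<close>, where both facts are known.\<close>

lemma isometric_map:
  assumes p: "quadratic_form K p" and q: "quadratic_form K q" and iso: "isometric K p q"
  shows "isometric L (map_qform \<phi> p) (map_qform \<phi> q)"
proof -
  let ?m = "qdim p" and ?n = "qdim q"
  obtain f where f: "isometry K p q f" using iso by (auto simp: isometric_iff)
  define g where "g = inv_into (vecs K ?m) f"
  have g: "isometry K q p g" unfolding g_def by (rule K.isometry_inverse[OF f])
  have gf: "g (f x) = x" if "x \<in> vecs K ?m" for x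
    unfolding g_def using bij_betw_inv_into_left[OF K.isometryD(2)[OF f] that] .
  have fg: "f (g x) = x" if "x \<in> vecs K ?n" for x
    unfolding g_def using bij_betw_inv_into_right[OF K.isometryD(2)[OF f] that] .
  note fl = K.isometryD(1)[OF f] and gl = K.isometryD(1)[OF g]
  obtain F where F: "linear_map L ?m ?n F" "\<And>x. x \<in> vecs K ?m \<Longrightarrow> F (\<phi> \<circ> x) = \<phi> \<circ> f x"
    using linear_map_extend[OF fl] by metis
  obtain G where G: "linear_map L ?n ?m G" "\<And>x. x \<in> vecs K ?n \<Longrightarrow> G (\<phi> \<circ> x) = \<phi> \<circ> g x"
    using linear_map_extend[OF gl] by metis
  have Fe: "F (unit_vec L i) = \<phi> \<circ> f (unit_vec K i)" if "i < ?m" for i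
    using F(2)[of "unit_vec K i"] that by (simp add: hom_unit_vec)
  have Ge: "G (unit_vec L i) = \<phi> \<circ> g (unit_vec K i)" if "i < ?n" for i
    using G(2)[of "unit_vec K i"] that by (simp add: hom_unit_vec)
  have GF: "G (F x) = x" if "x \<in> vecs L ?m" for x
    using L.linear_map_eq_on_basis[OF L.linear_map_comp[OF F(1) G(1)] L.linear_map_id _ that]
      G(2) K.linear_map_closed[OF fl] by (simp add: Fe gf hom_unit_vec)
  have FG: "F (G x) = x" if "x \<in> vecs L ?n" for x
    using L.linear_map_eq_on_basis[OF L.linear_map_comp[OF G(1) F(1)] L.linear_map_id _ that]
      F(2) K.linear_map_closed[OF gl] by (simp add: Ge fg hom_unit_vec)
  have lin: "linear_iso L ?m ?n F"
    using GF FG L.linear_map_closed[OF G(1)] by (intro L.linear_isoI[OF F(1), of G]) auto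
  interpret P': quadratic_map L ?m "qeval L (map_qform \<phi> p)" "qpolar L (map_qform \<phi> p)"
    using L.quadratic_map_qeval[OF quadratic_form_map[OF p]] by simp
  interpret Q': quadratic_map L ?n "qeval L (map_qform \<phi> q)" "qpolar L (map_qform \<phi> q)"
    using L.quadratic_map_qeval[OF quadratic_form_map[OF q]] by simp
  have "(qeval L (map_qform \<phi> q) \<circ> F) x = qeval L (map_qform \<phi> p) x" if x: "x \<in> vecs L ?m" for x
  proof (rule quadratic_map_eqI[OF Q'.quadratic_map_comp[OF F(1)] P'.quadratic_map_axioms _ _ x])
    show "(qeval L (map_qform \<phi> q) \<circ> F) (unit_vec L i) = qeval L (map_qform \<phi> p) (unit_vec L i)"
      if i: "i < ?m" for i
      using K.isometryD(3)[OF f, of "unit_vec K i"] i K.linear_map_closed[OF fl, of "unit_vec K i"]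
        qeval_map[OF p, of "unit_vec K i"] qeval_map[OF q, of "f (unit_vec K i)"]
      by (simp add: Fe hom_unit_vec)
    show "qpolar L (map_qform \<phi> q) (F (unit_vec L i)) (F (unit_vec L j))
        = qpolar L (map_qform \<phi> p) (unit_vec L i) (unit_vec L j)" if i: "i < j" "j < ?m" for i j
      using K.isometry_polar[OF f, of "unit_vec K i" "unit_vec K j"] i
        K.linear_map_closed[OF fl, of "unit_vec K i"] K.linear_map_closed[OF fl, of "unit_vec K j"]
        qpolar_map[OF p, of "unit_vec K i" "unit_vec K j"]
        qpolar_map[OF q, of "f (unit_vec K i)" "f (unit_vec K j)"]
      by (simp add: Fe hom_unit_vec)
  qed
  then have "isometry L (map_qform \<phi> p) (map_qform \<phi> q) F"
    using lin by (simp add: isometry_def)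
  then show ?thesis by (auto simp: isometric_iff)
qed

text \<open>Splitting off one-dimensional forms over \<open>K\<close> avoids determinants.\<close>

lemma regular_map: "regular_form K q \<Longrightarrow> regular_form L (map_qform \<phi> q)"
proof (induction "qdim q" arbitrary: q)
  case 0
  have "x = vec_zero L" if "x \<in> vecs L 0" for x
    using that by (auto simp: vecs_def vec_zero_def)
  then show ?case
    using 0 quadratic_form_map[OF K.regular_formD[OF 0(2)]] by (simp add: regular_form_def)
next
  case (Suc n)
  note q = K.regular_formD[OF Suc.prems]
  interpret Q: quadratic_map K "qdim q" "qeval K q" "qpolar K q"
    by (rule K.quadratic_map_qeval[OF q])
  \<comment> \<open>A form without nonzero values has zero polar form, so the first unit vector,
    present in positive dimension, would lie in the radical.\<close>
  have "\<exists>x \<in> vecs K (qdim q). qeval K q x \<noteq> \<zero>\<^bsub>K\<^esub>"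
  proof (rule ccontr)
    assume "\<not> (\<exists>x \<in> vecs K (qdim q). qeval K q x \<noteq> \<zero>\<^bsub>K\<^esub>)"
    then have 0: "qeval K q x = \<zero>\<^bsub>K\<^esub>" if "x \<in> vecs K (qdim q)" for x
      using that by auto
    have e: "unit_vec K 0 \<in> vecs K (qdim q)" using Suc.hyps(2)[symmetric] by simp
    have "qpolar K q (unit_vec K 0) y = \<zero>\<^bsub>K\<^esub>" if y: "y \<in> vecs K (qdim q)" for y
      using y e by (simp add: qpolar_def 0 K.minus_eq)
    then have "unit_vec K 0 = vec_zero K"
      using Suc.prems e by (auto simp: regular_form_def)
    from fun_cong[OF this, of 0] show False by (simp add: unit_vec_def vec_zero_def)
  qed
  then obtain x where x: "x \<in> vecs K (qdim q)" "qeval K q x \<noteq> \<zero>\<^bsub>K\<^esub>" by auto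
  define a where "a = qeval K q x"
  have a: "a \<in> carrier K" "a \<noteq> \<zero>\<^bsub>K\<^esub>" using x by (auto simp: a_def)
  obtain q' f where q': "quadratic_form K q'" "qdim q = Suc (qdim q')"
    and f: "isometry K (orth_sum K (unary_form a) q') q f"
    using K.split_unary[OF q x(1) a_def[symmetric] a(2)] by metis
  have iso: "isometric K (orth_sum K (unary_form a) q') q"
    using f by (auto simp: isometric_iff)
  have "regular_form K (orth_sum K (unary_form a) q')"
    using K.regular_isometric[OF Suc.prems _ K.isometric_sym[OF iso]] q' a by simp
  then have "regular_form K q'" using q' a by (simp add: K.regular_orth_sum_iff)
  then have r': "regular_form L (map_qform \<phi> q')"
    using Suc.hyps q' by simp
  have "regular_form L (map_qform \<phi> (orth_sum K (unary_form a) q'))"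
    unfolding map_orth_sum map_unary_form
    using r' a q' hom_nonzero[OF a] L.regular_unary[of "\<phi> a"]
    by (simp add: L.regular_orth_sum_iff quadratic_form_map)
  then show ?case
    using L.regular_isometric[OF _ quadratic_form_map[OF q] isometric_map[OF _ q iso]] q' a by simp
qed

end

section \<open>The completion at a discrete valuation\<close>

locale valued_field = field K for K (structure) +
  fixes v :: "'a \<Rightarrow> int"
  assumes valuation: "discrete_valuation K v"
begin

section \<open>Rules for lower bounds on the valuation\<close>

abbreviation "ge \<equiv> val_ge K v"

lemma v_mult:
  "x \<in> carrier K \<Longrightarrow> x \<noteq> \<zero> \<Longrightarrow> y \<in> carrier K \<Longrightarrow> y \<noteq> \<zero> \<Longrightarrow> v (x \<otimes> y) = v x + v y"
  using valuation by (simp add: discrete_valuation_def)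

lemma v_one: "v \<one> = 0"
  using v_mult[of \<one> \<one>] by simp

text \<open>Twice this integer is the valuation of (-1)(-1) = 1, which is 0.\<close>

lemma v_minus_one: "v (\<ominus> \<one>) = 0"
proof -
  have "\<ominus> \<one> \<noteq> \<zero>" by (metis minus_minus minus_zero one_closed one_not_zero)
  then show ?thesis using v_mult[of "\<ominus> \<one>" "\<ominus> \<one>"] v_one by (simp add: l_minus)
qed

lemma ge_zero [simp]: "ge \<zero> N"
  by (simp add: val_ge_def)

lemma ge_mono: "ge x N \<Longrightarrow> M \<le> N \<Longrightarrow> ge x M"
  by (auto simp: val_ge_def)

lemma ge_add: "ge x N \<Longrightarrow> ge y N \<Longrightarrow> x \<in> carrier K \<Longrightarrow> y \<in> carrier K \<Longrightarrow> ge (x \<oplus> y) N"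
  using valuation unfolding val_ge_def discrete_valuation_def
  by (cases "x = \<zero>"; cases "y = \<zero>") (fastforce simp: min_le_iff_disj)+

lemma ge_mult:
  "ge x M \<Longrightarrow> ge y N \<Longrightarrow> x \<in> carrier K \<Longrightarrow> y \<in> carrier K \<Longrightarrow> ge (x \<otimes> y) (M + N)"
  unfolding val_ge_def by (cases "x = \<zero>"; cases "y = \<zero>") (auto simp: v_mult)

lemma ge_neg: "ge x N \<Longrightarrow> x \<in> carrier K \<Longrightarrow> ge (\<ominus> x) N"
  using ge_mult[of "\<ominus> \<one>" 0 x N] v_minus_one by (simp add: val_ge_def l_minus)

lemma ge_minus: "ge x N \<Longrightarrow> ge y N \<Longrightarrow> x \<in> carrier K \<Longrightarrow> y \<in> carrier K \<Longrightarrow> ge (x \<ominus> y) N"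
  unfolding minus_eq by (intro ge_add ge_neg) auto

text \<open>Zero satisfies every bound \<open>ge\<close>, so a failed bound means that
  \<open>x\<close> is nonzero with v x < N; the inverse then has valuation above -N. This controls
  the inverse of a sequence that stays away from zero.\<close>

lemma not_ge_inv:
  assumes x: "x \<in> carrier K" and n: "\<not> ge x N"
  shows "x \<noteq> \<zero>" "inv x \<in> carrier K" "x \<otimes> inv x = \<one>" "ge (inv x) (- N)"
proof -
  show x0: "x \<noteq> \<zero>" using n by (auto simp: val_ge_def)
  then have u: "x \<in> Units K" using x by (simp add: field_Units)
  then show i: "inv x \<in> carrier K" "x \<otimes> inv x = \<one>" by auto
  then have "inv x \<noteq> \<zero>" using x by auto
  then have "v x + v (inv x) = 0" using v_mult[OF x x0 i(1)] i v_one by simp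
  then show "ge (inv x) (- N)" using n by (auto simp: val_ge_def)
qed

section \<open>Cauchy sequences and null sequences\<close>

abbreviation "\<C> \<equiv> cauchy_seqs K v"

abbreviation "\<N> \<equiv> null_seqs K v"

lemma cauchyI:
  assumes "\<And>n. s n \<in> carrier K"
    and "\<And>N. \<exists>M. \<forall>m\<ge>M. \<forall>n\<ge>M. ge (s m \<ominus> s n) N"
  shows "s \<in> \<C>"
  using assms by (auto simp: cauchy_seqs_def)

lemma cauchy_carrier: "s \<in> \<C> \<Longrightarrow> s n \<in> carrier K"
  by (auto simp: cauchy_seqs_def)

lemma cauchyD:
  assumes "s \<in> \<C>"
  obtains M where "\<And>m n. m \<ge> M \<Longrightarrow> n \<ge> M \<Longrightarrow> ge (s m \<ominus> s n) N"
proof -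
  have "\<exists>M. \<forall>m\<ge>M. \<forall>n\<ge>M. ge (s m \<ominus> s n) N"
    using assms by (simp add: cauchy_seqs_def)
  then show ?thesis using that by auto
qed

lemma cauchy_const: "c \<in> carrier K \<Longrightarrow> (\<lambda>n. c) \<in> \<C>"
  by (rule cauchyI) (auto simp: minus_eq r_neg)

lemma cauchy_add:
  assumes s: "s \<in> \<C>" and t: "t \<in> \<C>"
  shows "(\<lambda>n. s n \<oplus> t n) \<in> \<C>"
proof (rule cauchyI)
  note sc = cauchy_carrier[OF s] and tc = cauchy_carrier[OF t]
  show "s n \<oplus> t n \<in> carrier K" for n using sc tc by simp
  fix N
  obtain M1 where 1: "\<And>m n. m \<ge> M1 \<Longrightarrow> n \<ge> M1 \<Longrightarrow> ge (s m \<ominus> s n) N"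
    by (rule cauchyD[OF s, where N = N]) blast
  obtain M2 where 2: "\<And>m n. m \<ge> M2 \<Longrightarrow> n \<ge> M2 \<Longrightarrow> ge (t m \<ominus> t n) N"
    by (rule cauchyD[OF t, where N = N]) blast
  have "ge (s m \<oplus> t m \<ominus> (s n \<oplus> t n)) N" if "m \<ge> max M1 M2" "n \<ge> max M1 M2" for m n
  proof -
    have "s m \<oplus> t m \<ominus> (s n \<oplus> t n) = (s m \<ominus> s n) \<oplus> (t m \<ominus> t n)"
      using sc[of m] sc[of n] tc[of m] tc[of n] by algebra
    then show ?thesis using 1[of m n] 2[of m n] that sc tc by (simp add: ge_add)
  qed
  then show "\<exists>M. \<forall>m\<ge>M. \<forall>n\<ge>M. ge (s m \<oplus> t m \<ominus> (s n \<oplus> t n)) N" by blast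
qed

lemma cauchy_bounded:
  assumes s: "s \<in> \<C>"
  obtains N M where "\<And>n. n \<ge> M \<Longrightarrow> ge (s n) N"
proof -
  note sc = cauchy_carrier[OF s]
  obtain M where M: "\<And>m n. m \<ge> M \<Longrightarrow> n \<ge> M \<Longrightarrow> ge (s m \<ominus> s n) 0"
    by (rule cauchyD[OF s, where N = 0]) blast
  \<comment> \<open>If \<open>s M\<close> is zero, \<open>v (s M)\<close> is an arbitrary integer,
    but \<open>ge\<close> holds for zero anyway and the minimum with 0 still bounds the difference
    to \<open>s M\<close>.\<close>
  have "ge (s n) (min 0 (v (s M)))" if "n \<ge> M" for n
  proof -
    have "s n = (s n \<ominus> s M) \<oplus> s M" using sc[of n] sc[of M] by algebra
    moreover have "ge (s M) (min 0 (v (s M)))" by (simp add: val_ge_def)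
    moreover have "ge (s n \<ominus> s M) (min 0 (v (s M)))" using M[OF that le_refl] by (rule ge_mono) simp
    ultimately show ?thesis using ge_add[of "s n \<ominus> s M" _ "s M"] sc by simp
  qed
  then show ?thesis using that by blast
qed

lemma cauchy_mult:
  assumes s: "s \<in> \<C>" and t: "t \<in> \<C>"
  shows "(\<lambda>n. s n \<otimes> t n) \<in> \<C>"
proof (rule cauchyI)
  note sc = cauchy_carrier[OF s] and tc = cauchy_carrier[OF t]
  show "s n \<otimes> t n \<in> carrier K" for n using sc tc by simp
  fix N
  obtain A M3 where 3: "\<And>n. n \<ge> M3 \<Longrightarrow> ge (s n) A" by (rule cauchy_bounded[OF s]) blast
  obtain B M4 where 4: "\<And>n. n \<ge> M4 \<Longrightarrow> ge (t n) B" by (rule cauchy_bounded[OF t]) blast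
  \<comment> \<open>In s_m t_m - s_n t_n = s_m (t_m - t_n) + (s_m - s_n) t_n the outer factors have
    valuation at least \<open>A\<close> and \<open>B\<close>; the differences must make up the rest
    to \<open>N\<close>.\<close>
  obtain M1 where 1: "\<And>m n. m \<ge> M1 \<Longrightarrow> n \<ge> M1 \<Longrightarrow> ge (s m \<ominus> s n) (N - B)"
    by (rule cauchyD[OF s, where N = "N - B"]) blast
  obtain M2 where 2: "\<And>m n. m \<ge> M2 \<Longrightarrow> n \<ge> M2 \<Longrightarrow> ge (t m \<ominus> t n) (N - A)"
    by (rule cauchyD[OF t, where N = "N - A"]) blast
  have "ge (s m \<otimes> t m \<ominus> s n \<otimes> t n) N"
    if "m \<ge> max (max M1 M2) (max M3 M4)" "n \<ge> max (max M1 M2) (max M3 M4)" for m n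
  proof -
    have "s m \<otimes> t m \<ominus> s n \<otimes> t n = s m \<otimes> (t m \<ominus> t n) \<oplus> (s m \<ominus> s n) \<otimes> t n"
      using sc[of m] sc[of n] tc[of m] tc[of n] by algebra
    moreover have "ge (s m \<otimes> (t m \<ominus> t n)) N"
      using ge_mult[OF 3[of m] 2[of m n]] that sc tc by simp
    moreover have "ge ((s m \<ominus> s n) \<otimes> t n) N"
      using ge_mult[OF 1[of m n] 4[of n]] that sc tc by simp
    ultimately show ?thesis using sc tc by (simp add: ge_add)
  qed
  then show "\<exists>M. \<forall>m\<ge>M. \<forall>n\<ge>M. ge (s m \<otimes> t m \<ominus> s n \<otimes> t n) N" by blast
qed

lemma cauchy_neg: "s \<in> \<C> \<Longrightarrow> (\<lambda>n. \<ominus> s n) \<in> \<C>"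
  using cauchy_mult[OF cauchy_const[of "\<ominus> \<one>"], of s] cauchy_carrier[of s] by (simp add: l_minus)

lemma nullI:
  assumes "s \<in> \<C>" "\<And>N. \<exists>M. \<forall>n\<ge>M. ge (s n) N"
  shows "s \<in> \<N>"
  using assms by (simp add: null_seqs_def)

lemma null_cauchy: "s \<in> \<N> \<Longrightarrow> s \<in> \<C>"
  by (simp add: null_seqs_def)

lemma nullD:
  assumes "s \<in> \<N>"
  obtains M where "\<And>n. n \<ge> M \<Longrightarrow> ge (s n) N"
proof -
  have "\<exists>M. \<forall>n\<ge>M. ge (s n) N"
    using assms by (simp add: null_seqs_def)
  then show ?thesis using that by auto
qed

lemma null_add:
  assumes s: "s \<in> \<N>" and t: "t \<in> \<N>"
  shows "(\<lambda>n. s n \<oplus> t n) \<in> \<N>"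
proof (rule nullI)
  note sc = cauchy_carrier[OF null_cauchy[OF s]] and tc = cauchy_carrier[OF null_cauchy[OF t]]
  show "(\<lambda>n. s n \<oplus> t n) \<in> \<C>" by (rule cauchy_add[OF null_cauchy[OF s] null_cauchy[OF t]])
  fix N
  obtain M1 where 1: "\<And>n. n \<ge> M1 \<Longrightarrow> ge (s n) N" by (rule nullD[OF s, where N = N]) blast
  obtain M2 where 2: "\<And>n. n \<ge> M2 \<Longrightarrow> ge (t n) N" by (rule nullD[OF t, where N = N]) blast
  have "ge (s n \<oplus> t n) N" if "n \<ge> max M1 M2" for n
    using 1[of n] 2[of n] that sc tc by (simp add: ge_add)
  then show "\<exists>M. \<forall>n\<ge>M. ge (s n \<oplus> t n) N" by blast
qed

lemma null_mult:
  assumes s: "s \<in> \<C>" and t: "t \<in> \<N>"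
  shows "(\<lambda>n. s n \<otimes> t n) \<in> \<N>"
proof (rule nullI)
  note sc = cauchy_carrier[OF s] and tc = cauchy_carrier[OF null_cauchy[OF t]]
  show "(\<lambda>n. s n \<otimes> t n) \<in> \<C>" by (rule cauchy_mult[OF s null_cauchy[OF t]])
  fix N
  obtain A M1 where 1: "\<And>n. n \<ge> M1 \<Longrightarrow> ge (s n) A" by (rule cauchy_bounded[OF s]) blast
  obtain M2 where 2: "\<And>n. n \<ge> M2 \<Longrightarrow> ge (t n) (N - A)" by (rule nullD[OF t, where N = "N - A"]) blast
  have "ge (s n \<otimes> t n) N" if "n \<ge> max M1 M2" for n
    using ge_mult[OF 1[of n] 2[of n]] that sc tc by simp
  then show "\<exists>M. \<forall>n\<ge>M. ge (s n \<otimes> t n) N" by blast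
qed

lemma null_zero: "(\<lambda>n. \<zero>) \<in> \<N>"
  by (rule nullI) (auto intro: cauchy_const)

lemma one_not_null: "(\<lambda>n. \<one>) \<notin> \<N>"
proof
  assume "(\<lambda>n. \<one>) \<in> \<N>"
  then obtain M where "\<And>n::nat. n \<ge> M \<Longrightarrow> ge \<one> 1" by (rule nullD[where N = 1]) blast
  then show False using v_one by (auto simp: val_ge_def)
qed

text \<open>A sequence that is not null misses some bound \<open>N\<close> infinitely often. Once
  its terms agree up to that same bound, all of them miss it, so the tail is nonzero with controlled
  inverses.\<close>

lemma cauchy_inverse:
  assumes s: "s \<in> \<C>" and not_null: "s \<notin> \<N>"
  obtains t where "t \<in> \<C>" "(\<lambda>n. \<one> \<ominus> s n \<otimes> t n) \<in> \<N>"
proof -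
  note sc = cauchy_carrier[OF s]
  obtain N where N: "\<And>M. \<exists>n\<ge>M. \<not> ge (s n) N"
    using nullI[OF s] not_null by blast
  obtain M where M: "\<And>m n. m \<ge> M \<Longrightarrow> n \<ge> M \<Longrightarrow> ge (s m \<ominus> s n) N"
    by (rule cauchyD[OF s, where N = N]) blast
  obtain n0 where n0: "n0 \<ge> M" "\<not> ge (s n0) N" using N by blast
  have n: "\<not> ge (s m) N" if m: "m \<ge> M" for m
  proof
    assume "ge (s m) N"
    then have "ge (s m \<ominus> (s m \<ominus> s n0)) N" using M[OF m n0(1)] sc by (simp add: ge_minus)
    moreover have "s m \<ominus> (s m \<ominus> s n0) = s n0" using sc[of m] sc[of n0] by algebra
    ultimately show False using n0 by simp
  qed
  note inv = not_ge_inv[OF sc n]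
  \<comment> \<open>The value at indices before \<open>M\<close> is arbitrary, since finitely many
    terms affect neither the Cauchy property nor the class modulo null sequences.\<close>
  define t where "t = (\<lambda>n. if n \<ge> M then inv (s n) else \<zero>)"
  have tc: "t n \<in> carrier K" for n using inv(2)[of n] by (auto simp: t_def)
  have t: "t \<in> \<C>"
  proof (rule cauchyI)
    show "t n \<in> carrier K" for n by (rule tc)
    fix N'
    \<comment> \<open>1/s_m - 1/s_n = (s_n - s_m) / (s_m s_n), where each inverse is only known to
      have valuation at least -N; the two summands \<open>N\<close> compensate for this.\<close>
    obtain M' where M': "\<And>m n. m \<ge> M' \<Longrightarrow> n \<ge> M' \<Longrightarrow> ge (s m \<ominus> s n) (N' + N + N)"
      by (rule cauchyD[OF s, where N = "N' + N + N"]) blast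
    have "ge (t m \<ominus> t n) N'" if m: "m \<ge> max M M'" and n': "n \<ge> max M M'" for m n
    proof -
      have mM: "m \<ge> M" "n \<ge> M" using m n' by auto
      note im = inv[OF mM(1)] and i' = inv[OF mM(2)]
      have "t m \<ominus> t n = inv (s m) \<otimes> (s n \<otimes> inv (s n)) \<ominus> inv (s n) \<otimes> (s m \<otimes> inv (s m))"
        unfolding im(3) i'(3) using im i' mM by (simp add: t_def)
      also have "\<dots> = (s n \<ominus> s m) \<otimes> inv (s m) \<otimes> inv (s n)"
        using sc[of m] sc[of n] im(2) i'(2) by algebra
      finally show ?thesis
        using ge_mult[OF ge_mult[OF M'[of n m] im(4)] i'(4)] m n' sc im(2) i'(2) by simp
    qed
    then show "\<exists>M. \<forall>m\<ge>M. \<forall>n\<ge>M. ge (t m \<ominus> t n) N'" by blast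
  qed
  have "(\<lambda>n. \<one> \<oplus> \<ominus> (s n \<otimes> t n)) \<in> \<C>"
    using s t by (intro cauchy_add cauchy_neg cauchy_mult cauchy_const) auto
  moreover have "\<one> \<ominus> s n \<otimes> t n = \<zero>" if "n \<ge> M" for n
    using inv[OF that] that by (simp add: t_def minus_eq r_neg)
  ultimately have "(\<lambda>n. \<one> \<ominus> s n \<otimes> t n) \<in> \<N>"
    by (intro nullI) (auto simp: minus_eq intro!: exI[of _ M])
  then show ?thesis using that t by blast
qed

section \<open>The completion as a residue field of the ring of Cauchy sequences\<close>

abbreviation "CR \<equiv> cauchy_ring K v"

lemma cauchy_ring_simps [simp]:
  "carrier CR = \<C>" "s \<otimes>\<^bsub>CR\<^esub> t = (\<lambda>n. s n \<otimes> t n)" "\<one>\<^bsub>CR\<^esub> = (\<lambda>n. \<one>)"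
  "\<zero>\<^bsub>CR\<^esub> = (\<lambda>n. \<zero>)" "s \<oplus>\<^bsub>CR\<^esub> t = (\<lambda>n. s n \<oplus> t n)"
  by (simp_all add: cauchy_ring_def)

lemma cring_cauchy_ring: "cring CR"
proof (rule cringI)
  show "abelian_group CR"
  proof (rule abelian_groupI)
    show "\<exists>y \<in> carrier CR. y \<oplus>\<^bsub>CR\<^esub> s = \<zero>\<^bsub>CR\<^esub>" if "s \<in> carrier CR" for s
      using that cauchy_neg[of s] cauchy_carrier[of s]
      by (intro bexI[of _ "\<lambda>n. \<ominus> s n"]) (auto simp: l_neg)
  qed (auto simp: cauchy_carrier cauchy_add cauchy_const a_ac)
  show "comm_monoid CR"
    by (rule comm_monoidI) (auto simp: cauchy_carrier cauchy_mult cauchy_const m_ac)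
qed (auto simp: cauchy_carrier l_distr)

lemma ideal_null_seqs: "ideal \<N> CR"
proof -
  interpret C: cring CR by (rule cring_cauchy_ring)
  have neg: "\<ominus>\<^bsub>CR\<^esub> s = (\<lambda>n. \<ominus> s n)" if "s \<in> \<C>" for s
    using that cauchy_neg[OF that] by (intro C.minus_equality) (auto simp: l_neg cauchy_carrier)
  show ?thesis
  proof (rule idealI[OF C.ring_axioms])
    show "subgroup \<N> (add_monoid CR)"
    proof (rule C.add.subgroupI)
      show "\<N> \<noteq> {}" using null_zero by blast
      show "\<ominus>\<^bsub>CR\<^esub> s \<in> \<N>" if "s \<in> \<N>" for s
        using null_mult[OF cauchy_const[of "\<ominus> \<one>"] that] cauchy_carrier[OF null_cauchy[OF that]]
        by (simp add: neg[OF null_cauchy[OF that]] l_minus)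
    qed (auto intro: null_cauchy null_add)
    show "x \<otimes>\<^bsub>CR\<^esub> a \<in> \<N>" if "a \<in> \<N>" "x \<in> carrier CR" for a x
      using null_mult that by simp
    then show "a \<otimes>\<^bsub>CR\<^esub> x \<in> \<N>" if "a \<in> \<N>" "x \<in> carrier CR" for a x
      using that C.m_comm[of a x] null_cauchy[of a] by simp
  qed
qed

text \<open>A larger ideal contains some \<open>s\<close> that is not null, hence s t and 1 - s t
  for the inverse \<open>t\<close> modulo null sequences from \<open>cauchy_inverse\<close>, and so
  their sum 1.\<close>

lemma maximalideal_null_seqs: "maximalideal \<N> CR"
proof (rule maximalidealI[OF ideal_null_seqs])
  show "carrier CR \<noteq> \<N>" using one_not_null cauchy_const[of \<one>] by auto
  fix J assume J: "ideal J CR" "\<N> \<subseteq> J" "J \<subseteq> carrier CR"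
  interpret J: ideal J CR by fact
  show "J = \<N> \<or> J = carrier CR"
  proof (cases "J = \<N>")
    case False
    then obtain s where s: "s \<in> J" "s \<notin> \<N>" "s \<in> \<C>" using J by auto
    obtain t where t: "t \<in> \<C>" "(\<lambda>n. \<one> \<ominus> s n \<otimes> t n) \<in> \<N>"
      by (rule cauchy_inverse[OF s(3,2)]) blast
    have "s \<otimes>\<^bsub>CR\<^esub> t \<in> J" using J.I_r_closed[OF s(1)] t by simp
    then have "s \<otimes>\<^bsub>CR\<^esub> t \<oplus>\<^bsub>CR\<^esub> (\<lambda>n. \<one> \<ominus> s n \<otimes> t n) \<in> J"
      using J.a_closed t J(2) by blast
    moreover have "a \<oplus> (\<one> \<ominus> a) = \<one>" if "a \<in> carrier K" for a
      using that by algebra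
    ultimately have "\<one>\<^bsub>CR\<^esub> \<in> J"
      using cauchy_carrier[OF s(3)] cauchy_carrier[OF t(1)] by simp
    then show ?thesis using J.one_imp_carrier by simp
  qed simp
qed

lemma field_completion: "field (completion K v)"
  unfolding completion_def
  by (rule maximalideal.quotient_is_field[OF maximalideal_null_seqs cring_cauchy_ring])

lemma completion_embed_hom: "completion_embed K v \<in> ring_hom K (completion K v)"
proof -
  have "(\<lambda>c n. c) \<in> ring_hom K CR"
    by (rule ring_hom_memI) (auto simp: cauchy_const)
  from ring_hom_trans[OF this ideal.rcos_ring_hom[OF ideal_null_seqs]]
  show ?thesis by (simp add: completion_def completion_embed_def[abs_def] o_def)
qed

end

section \<open>Shifting the local-global principle\<close>

text \<open>The indices of the enlarged form exceed those of \<open>q\<close> by exactly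
  \<open>m\<close> on both sides of the implication, so \<open>m\<close> cancels. The bounds are
  integers, hence the subtraction never truncates.\<close>

lemma LGP_shift_down:
  fixes K :: "('a, 'b) ring_scheme"
  assumes K: "field_char_not_2 K"
    and hom: "\<And>v. v \<in> V \<Longrightarrow> field_hom K (completion K v) (completion_embed K v)"
    and lgp: "\<And>q. regular_form K q \<Longrightarrow> LGP K V a b q"
    and q: "regular_form K q"
  shows "LGP K V (a - int m) (b - int m) q"
  unfolding LGP_def
proof
  interpret K: field_char_not_2 K by (rule K)
  let ?p = "orth_sum K (hyperbolic_form K m) q"
  assume loc: "\<forall>v \<in> V. a - int m \<le> int (witt_index (completion K v) (base_change K v q))"
  have "a \<le> int (witt_index (completion K v) (base_change K v ?p))" if v: "v \<in> V" for v
  proof -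
    interpret field_hom K "completion K v" "completion_embed K v" by (rule hom[OF v])
    show ?thesis
      using loc[rule_format, OF v] L.witt_index_hyperbolic_form[OF regular_map[OF q], of m]
      by (simp add: base_change_def map_orth_sum map_hyperbolic_form)
  qed
  then have "b \<le> int (witt_index K ?p)"
    using lgp[OF K.regular_hyperbolic_form_orth_sum[OF q, of m]] by (simp add: LGP_def)
  then show "b - int m \<le> int (witt_index K q)"
    using K.witt_index_hyperbolic_form[OF q, of m] by simp
qed

text \<open>The induction hypothesis serves twice. For \<open>q\<close> it gives a global index of
  at least \<open>b + m\<close>, positive by \<open>b \<ge> 1\<close>, and so a plane to split off;
  for the complement \<open>p\<close>, whose indices are all one lower, it gives the bound that this
  plane then raises by one.\<close>

lemma LGP_shift_up:
  fixes K :: "('a, 'b) ring_scheme"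
  assumes K: "field_char_not_2 K"
    and hom: "\<And>v. v \<in> V \<Longrightarrow> field_hom K (completion K v) (completion_embed K v)"
    and b: "b \<ge> 1"
    and lgp: "\<And>q. regular_form K q \<Longrightarrow> LGP K V a b q"
    and q: "regular_form K q"
  shows "LGP K V (a + int m) (b + int m) q"
  using q
proof (induction m arbitrary: q)
  case 0
  then show ?case using lgp by simp
next
  case (Suc m)
  interpret K: field_char_not_2 K by (rule K)
  show ?case
    unfolding LGP_def
  proof
    assume loc: "\<forall>v \<in> V. a + int (Suc m) \<le> int (witt_index (completion K v) (base_change K v q))"
    have "b + int m \<le> int (witt_index K q)"
      using Suc.IH[OF Suc.prems] loc by (force simp: LGP_def)
    then have "witt_index K q > 0" using b by simp
    then obtain p where p: "regular_form K p" and iso: "isometric K q (orth_sum K (hyperbolic_plane K) p)"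
      using K.witt_index_pos_split[OF Suc.prems] by metis
    have Hp: "regular_form K (orth_sum K (hyperbolic_plane K) p)"
      using p K.regular_hyperbolic_plane by (simp add: K.regular_orth_sum_iff K.regular_formD)
    have "a + int m \<le> int (witt_index (completion K v) (base_change K v p))" if v: "v \<in> V" for v
    proof -
      interpret field_hom K "completion K v" "completion_embed K v" by (rule hom[OF v])
      have "witt_index (completion K v) (base_change K v q)
          = Suc (witt_index (completion K v) (base_change K v p))"
        using L.witt_index_isometric[OF regular_map[OF Hp]
            isometric_map[OF K.regular_formD[OF Suc.prems] K.regular_formD[OF Hp] iso]]
          L.witt_index_hyperbolic_plane[OF regular_map[OF p]]
        by (simp add: base_change_def map_orth_sum map_hyperbolic_plane)
      then show ?thesis using loc[rule_format, OF v] by simp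
    qed
    then have "b + int m \<le> int (witt_index K p)"
      using Suc.IH[OF p] by (simp add: LGP_def)
    then show "b + int (Suc m) \<le> int (witt_index K q)"
      using K.witt_index_isometric[OF Hp iso] K.witt_index_hyperbolic_plane[OF p] by simp
  qed
qed

theorem theorem2p26:
  fixes k :: "('a, 'b) ring_scheme" and V :: "('a \<Rightarrow> int) set" and r s j :: int
  assumes "field k"
    and "\<one>\<^bsub>k\<^esub> \<oplus>\<^bsub>k\<^esub> \<one>\<^bsub>k\<^esub> \<noteq> \<zero>\<^bsub>k\<^esub>"
    and "V \<noteq> {}"
    and "\<And>v. v \<in> V \<Longrightarrow> discrete_valuation k v \<and> nontrivial_valuation k v"
    and "r \<ge> 1" and "s \<ge> 1"
    and "\<And>q. regular_form k q \<Longrightarrow> LGP k V r s q"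
    and "r + j \<ge> 1" and "s + j \<ge> 1"
  shows "\<forall>q. regular_form k q \<longrightarrow> LGP k V (r + j) (s + j) q"
proof (intro allI impI)
  fix q assume q: "regular_form k q"
  have k: "field_char_not_2 k"
    using assms(1,2) by (simp add: field_char_not_2_def field_char_not_2_axioms_def)
  have hom: "field_hom k (completion k v) (completion_embed k v)" if "v \<in> V" for v
  proof -
    interpret valued_field k v
      using assms(1,4) that by (simp add: valued_field_def valued_field_axioms_def)
    show ?thesis
      using k field_completion completion_embed_hom
        by (simp add: field_hom_def field_hom_axioms_def)
  qed
  show "LGP k V (r + j) (s + j) q"
  proof (cases "j \<ge> 0")
    case True
    then show ?thesis
      using LGP_shift_up[OF k hom assms(6,7) q, of "nat j"] by simp
  next
    case False
    then show ?thesis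
      using LGP_shift_down[OF k hom assms(7) q, of "nat (- j)"] by simp
  qed
qed

end
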